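(* Let $m,\ell\in\mathbb{N}$ with $1\le \ell\leq m$ and $(m,\ell)\neq(1,1)$, and let $\alpha\in(0,\frac{\pi}{2})$. Let $u^{(\ell)}=(u^{(\ell)}_{i_1\dots i_\ell})_{1\le i_1,\dots,i_\ell\le m}\colon\mathbb{R}^m\setminus\{0\}\to\mathbb{S}^{m^\ell-1}\subset\mathbb{R}^{m^\ell}$ be Nakauchi's generalized radial projection map (defined in the context). The map $q\colon\mathbb{R}^{m}\setminus\{0\}\rightarrow \mathbb{S}^{m^{\ell}}\subset\mathbb{R}^{m^\ell+1}$ given by $$q:=\big(\sin\alpha\cdot u^{(\ell)},\cos\alpha\big)$$ is a proper biharmonic map if and only if $$\sin^2\alpha=\frac{\ell(\ell+m-2)+2m-8}{2\ell(\ell+m-2)}.$$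
   Context: Nakauchi's maps: for $x\in\mathbb{R}^m\setminus\{0\}$ put $r=|x|$ and $y_i=x_i/r$. For $\ell=1$ set $u^{(1)}_{i_1}(x)=y_{i_1}$, and for $\ell\geq 2$ define recursively $$u^{(\ell)}_{i_1\ldots i_\ell}(x)=C_{\ell,m}\Big(y_{i_\ell}u^{(\ell-1)}_{i_1\ldots i_{\ell-1}}(x)-\frac{1}{\ell+m-3}\,r\frac{\partial}{\partial x_{i_\ell}}u^{(\ell-1)}_{i_1\ldots i_{\ell-1}}(x)\Big),\qquad C_{\ell,m}=\sqrt{\frac{\ell+m-3}{2\ell+m-4}}.$$ It is known (Nakauchi) that $u^{(\ell)}$ is a harmonic map into the unit sphere $\mathbb{S}^{m^\ell-1}$, i.e. $\Delta u^{(\ell)}+|\nabla u^{(\ell)}|^2u^{(\ell)}=0$, with $|\nabla u^{(\ell)}|^2=\frac{\ell(\ell+m-2)}{r^2}$, and that $\sum_{j=1}^m y_j\,\frac{\partial}{\partial x_j}u^{(\ell)}_{i_1\dots i_\ell}=0$. Spheres carry the round metric and $\mathbb{R}^m\setminus\{0\}$ the Euclidean metric. For a smooth map $\phi\colon (M,g)\to(N,h)$ between Riemannian manifolds, $\bar\nabla$ is the connection on $\phi^\ast TN$, the tension field is $\tau(\phi)=\operatorname{Tr}\bar\nabla d\phi$, and $\phi$ is harmonic if $\tau(\phi)=0$. The map $\phi$ is biharmonic if $$\bar\Delta\tau(\phi)-\sum_{j}R^N(\tau(\phi),d\phi(e_j))d\phi(e_j)\cdot(-1)=0,\quad\text{i.e.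 } \bar\Delta\tau(\phi)+\sum_{j}R^N(\tau(\phi),d\phi(e_j))d\phi(e_j)=0,$$ where $\{e_j\}$ is a local orthonormal frame of $TM$, $\bar\Delta=\operatorname{Tr}(\bar\nabla\bar\nabla-\bar\nabla_\nabla)$ (negative spectrum) and $R(X,Y)Z=[\nabla_X,\nabla_Y]Z-\nabla_{[X,Y]}Z$. Equivalently, for $u\colon M\to\mathbb{S}^n\subset\mathbb{R}^{n+1}$, biharmonicity means $$\Delta^2u+2\operatorname{div}(|\nabla u|^2\nabla u)-(\langle\Delta^2u,u\rangle-2|\nabla u|^4)u=0,$$ with $\Delta,\nabla$ acting componentwise. A biharmonic map is proper if it is not harmonic. *)

theory Defs
  imports "HOL-Analysis.Analysis"
begin

section \<open>Smooth maps on open subsets of Euclidean space\<close>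

text \<open>Meant for open \<open>S\<close>; the derivatives \<open>frechet_derivative f (at x) v\<close> are then the
  directional derivatives \<open>D\<^sub>v f(x)\<close>.\<close>

primrec Ck_on ::
  "nat \<Rightarrow> 'a::euclidean_space set \<Rightarrow> ('a \<Rightarrow> 'b::real_normed_vector) \<Rightarrow> bool" where
  "Ck_on 0 S f \<longleftrightarrow> continuous_on S f"
| "Ck_on (Suc k) S f \<longleftrightarrow>
     f differentiable_on S \<and> (\<forall>v. Ck_on k S (\<lambda>x. frechet_derivative f (at x) v))"

definition smooth_map_on ::
  "'a::euclidean_space set \<Rightarrow> ('a \<Rightarrow> 'b::real_normed_vector) \<Rightarrow> bool" where
  "smooth_map_on S f \<longleftrightarrow> (\<forall>k. Ck_on k S f)"


section \<open>The round unit sphere\<close>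

text \<open>The unit sphere \<open>sphere 0 1\<close> of a Euclidean space carries the induced metric, so tangent
  vectors at \<open>p\<close> are ambient vectors orthogonal to \<open>p\<close>, and the Levi-Civita connection is the
  tangential part of the ambient derivative. Vector fields on the sphere are represented by ambient
  extensions.\<close>

definition tangent_proj :: "'b::real_inner \<Rightarrow> 'b \<Rightarrow> 'b" where
  "tangent_proj p v = v - (v \<bullet> p) *\<^sub>R p"

definition sphere_conn ::
  "('b::euclidean_space \<Rightarrow> 'b) \<Rightarrow> ('b \<Rightarrow> 'b) \<Rightarrow> 'b \<Rightarrow> 'b" where
  "sphere_conn X Y p = tangent_proj p (frechet_derivative Y (at p) (X p))"

definition lie_bracket ::
  "('b::euclidean_space \<Rightarrow> 'b) \<Rightarrow> ('b \<Rightarrow> 'b) \<Rightarrow> 'b \<Rightarrow> 'b" where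
  "lie_bracket X Y p =
     frechet_derivative Y (at p) (X p) - frechet_derivative X (at p) (Y p)"

text \<open>\<open>R(X,Y)Z = [\<nabla>\<^sub>X, \<nabla>\<^sub>Y] Z - \<nabla>\<^bsub>[X,Y]\<^esub> Z\<close> at \<open>p\<close>. As \<open>R\<close> is a tensor, the
  tangent vectors \<open>X, Y, Z\<close> at \<open>p\<close> may be extended to any vector fields on the sphere; here the
  extension of \<open>X\<close> is \<open>z \<mapsto> tangent_proj z X\<close>.\<close>

definition sphere_curvature ::
  "'b::euclidean_space \<Rightarrow> 'b \<Rightarrow> 'b \<Rightarrow> 'b \<Rightarrow> 'b" where
  "sphere_curvature p X Y Z =
    (let X' = (\<lambda>z. tangent_proj z X); Y' = (\<lambda>z. tangent_proj z Y); Z' = (\<lambda>z. tangent_proj z Z)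
     in sphere_conn X' (sphere_conn Y' Z') p - sphere_conn Y' (sphere_conn X' Z') p
        - sphere_conn (lie_bracket X' Y') Z' p)"

lemma frechet_derivative_tangent_proj:
  fixes Z :: "'b::euclidean_space"
  shows "frechet_derivative (\<lambda>z. tangent_proj z Z) (at p) w
           = - (Z \<bullet> w) *\<^sub>R p - (Z \<bullet> p) *\<^sub>R w"
proof -
  have "((\<lambda>z. tangent_proj z Z) has_derivative (\<lambda>w. - (Z \<bullet> w) *\<^sub>R p - (Z \<bullet> p) *\<^sub>R w)) (at p)"
    unfolding tangent_proj_def
    by (auto intro!: derivative_eq_intros ext simp: algebra_simps)
  then show ?thesis
    by (metis frechet_derivative_at)
qed

lemma sphere_conn_sphere_conn_tangent_proj:
  fixes p :: "'b::euclidean_space"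
  assumes p: "norm p = 1" and tangent: "X \<bullet> p = 0" "Y \<bullet> p = 0" "Z \<bullet> p = 0"
  shows "sphere_conn (\<lambda>z. tangent_proj z X)
           (sphere_conn (\<lambda>z. tangent_proj z Y) (\<lambda>z. tangent_proj z Z)) p = - (Z \<bullet> X) *\<^sub>R Y"
proof -
  define H where "H = (\<lambda>z. - (Z \<bullet> (Y - (Y \<bullet> z) *\<^sub>R z)) *\<^sub>R z - (Z \<bullet> z) *\<^sub>R (Y - (Y \<bullet> z) *\<^sub>R z))"
  define H' where "H' = (\<lambda>w. - (Z \<bullet> Y) *\<^sub>R w - (Z \<bullet> w) *\<^sub>R Y)"
  have pp: "p \<bullet> p = 1"
    using p by (simp add: norm_eq_1)
  have t': "p \<bullet> X = 0" "p \<bullet> Y = 0" "p \<bullet> Z = 0"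
    using tangent by (simp_all add: inner_commute)
  have 1: "sphere_conn (\<lambda>z. tangent_proj z Y) (\<lambda>z. tangent_proj z Z) = (\<lambda>z. H z - (H z \<bullet> z) *\<^sub>R z)"
    unfolding sphere_conn_def frechet_derivative_tangent_proj
    by (simp add: tangent_proj_def H_def fun_eq_iff)
  have H: "(H has_derivative H') (at p)"
  proof -
    have "((\<lambda>z. - (Z \<bullet> Y - (Y \<bullet> z) * (Z \<bullet> z)) *\<^sub>R z - (Z \<bullet> z) *\<^sub>R (Y - (Y \<bullet> z) *\<^sub>R z))
        has_derivative (\<lambda>w. - (Z \<bullet> Y) *\<^sub>R w - (Z \<bullet> w) *\<^sub>R Y)) (at p)"
      by (rule has_derivative_eq_rhs, (rule has_derivative_diff has_derivative_scaleR
            has_derivative_minus has_derivative_mult has_derivative_inner_right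
            has_derivative_const has_derivative_ident)+) (simp add: fun_eq_iff tangent t')
    then show ?thesis
      by (simp only: H_def H'_def inner_diff_right inner_scaleR_right)
  qed
  have Hp: "H p = - (Z \<bullet> Y) *\<^sub>R p"
    by (simp add: H_def tangent)
  have "((\<lambda>z. H z - (H z \<bullet> z) *\<^sub>R z) has_derivative
      (\<lambda>w. H' w - ((H p \<bullet> p) *\<^sub>R w + (H p \<bullet> w + H' w \<bullet> p) *\<^sub>R p))) (at p)"
    by (rule has_derivative_diff[OF H has_derivative_scaleR[OF
            has_derivative_inner[OF H has_derivative_ident] has_derivative_ident]])
  then have "frechet_derivative (\<lambda>z. H z - (H z \<bullet> z) *\<^sub>R z) (at p) X
      = H' X - ((H p \<bullet> p) *\<^sub>R X + (H p \<bullet> X + H' X \<bullet> p) *\<^sub>R p)"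
    by (rule frechet_derivative_at[symmetric, THEN fun_cong])
  also have "\<dots> = - (Z \<bullet> X) *\<^sub>R Y"
    by (simp add: Hp H'_def pp tangent t' inner_diff_left)
  finally show ?thesis
    unfolding 1 by (simp add: sphere_conn_def tangent_proj_def tangent)
qed

lemma sphere_curvature_eq:
  fixes p :: "'b::euclidean_space"
  assumes "norm p = 1" "X \<bullet> p = 0" "Y \<bullet> p = 0" "Z \<bullet> p = 0"
  shows "sphere_curvature p X Y Z = (Y \<bullet> Z) *\<^sub>R X - (X \<bullet> Z) *\<^sub>R Y"
proof -
  have "lie_bracket (\<lambda>z. tangent_proj z X) (\<lambda>z. tangent_proj z Y) p = 0"
    using assms unfolding lie_bracket_def frechet_derivative_tangent_proj
    by (simp add: tangent_proj_def inner_commute)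
  then have "sphere_conn (lie_bracket (\<lambda>z. tangent_proj z X) (\<lambda>z. tangent_proj z Y))
      (\<lambda>z. tangent_proj z Z) p = 0"
    unfolding sphere_conn_def frechet_derivative_tangent_proj
    using assms by (simp add: tangent_proj_def)
  then show ?thesis
    using assms unfolding sphere_curvature_def Let_def
    by (simp add: sphere_conn_sphere_conn_tangent_proj inner_commute)
qed


section \<open>Harmonic and biharmonic maps into the sphere\<close>

text \<open>The domain is an open set \<open>S\<close> of a Euclidean space with the flat metric. The frame \<open>Basis\<close>
  is orthonormal and parallel, so the terms with \<open>\<nabla>\<^bsub>e\<^esub> e\<close> in \<open>Tr \<nabla>d\<phi>\<close> and in the rough
  Laplacian vanish.\<close>

definition pullback_conn ::
  "('a::euclidean_space \<Rightarrow> 'b::euclidean_space) \<Rightarrow> 'a \<Rightarrow> ('a \<Rightarrow> 'b) \<Rightarrow> 'a \<Rightarrow> 'b" where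
  "pullback_conn \<phi> e V x = tangent_proj (\<phi> x) (frechet_derivative V (at x) e)"

definition tension ::
  "('a::euclidean_space \<Rightarrow> 'b::euclidean_space) \<Rightarrow> 'a \<Rightarrow> 'b" where
  "tension \<phi> x =
     (\<Sum>e\<in>Basis. pullback_conn \<phi> e (\<lambda>y. frechet_derivative \<phi> (at y) e) x)"

definition rough_laplacian ::
  "('a::euclidean_space \<Rightarrow> 'b::euclidean_space) \<Rightarrow> ('a \<Rightarrow> 'b) \<Rightarrow> 'a \<Rightarrow> 'b" where
  "rough_laplacian \<phi> V x = (\<Sum>e\<in>Basis. pullback_conn \<phi> e (pullback_conn \<phi> e V) x)"

definition bitension ::
  "('a::euclidean_space \<Rightarrow> 'b::euclidean_space) \<Rightarrow> 'a \<Rightarrow> 'b" where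
  "bitension \<phi> x = rough_laplacian \<phi> (tension \<phi>) x +
     (\<Sum>e\<in>Basis. sphere_curvature (\<phi> x) (tension \<phi> x)
        (frechet_derivative \<phi> (at x) e) (frechet_derivative \<phi> (at x) e))"

definition smooth_sphere_map_on ::
  "'a::euclidean_space set \<Rightarrow> ('a \<Rightarrow> 'b::euclidean_space) \<Rightarrow> bool" where
  "smooth_sphere_map_on S \<phi> \<longleftrightarrow> open S \<and> smooth_map_on S \<phi> \<and> \<phi> ` S \<subseteq> sphere 0 1"

definition harmonic_map_on ::
  "'a::euclidean_space set \<Rightarrow> ('a \<Rightarrow> 'b::euclidean_space) \<Rightarrow> bool" where
  "harmonic_map_on S \<phi> \<longleftrightarrow> smooth_sphere_map_on S \<phi> \<and> (\<forall>x\<in>S. tension \<phi> x = 0)"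

definition biharmonic_map_on ::
  "'a::euclidean_space set \<Rightarrow> ('a \<Rightarrow> 'b::euclidean_space) \<Rightarrow> bool" where
  "biharmonic_map_on S \<phi> \<longleftrightarrow> smooth_sphere_map_on S \<phi> \<and> (\<forall>x\<in>S. bitension \<phi> x = 0)"

definition proper_biharmonic_map_on ::
  "'a::euclidean_space set \<Rightarrow> ('a \<Rightarrow> 'b::euclidean_space) \<Rightarrow> bool" where
  "proper_biharmonic_map_on S \<phi> \<longleftrightarrow> biharmonic_map_on S \<phi> \<and> \<not> harmonic_map_on S \<phi>"


section \<open>Nakauchi's maps\<close>

definition nakauchi_const :: "nat \<Rightarrow> nat \<Rightarrow> real" where
  "nakauchi_const l m = sqrt ((real l + real m - 3) / (2 * real l + real m - 4))"

text \<open>\<open>nakauchi_comp l i\<close> is the component of \<open>u\<^sup>(\<^sup>l\<^sup>)\<close> with multi-index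
  \<open>(i 1, \<dots>, i l)\<close>; other values of \<open>i\<close> are not used. The value for \<open>l = 0\<close> is a dummy.\<close>

fun nakauchi_comp :: "nat \<Rightarrow> (nat \<Rightarrow> 'm::finite) \<Rightarrow> real ^ 'm \<Rightarrow> real" where
  "nakauchi_comp 0 i = (\<lambda>x. 0)"
| "nakauchi_comp (Suc 0) i = (\<lambda>x. x $ i 1 / norm x)"
| "nakauchi_comp (Suc (Suc n)) i =
    (let l = Suc (Suc n); m = CARD('m); v = nakauchi_comp (Suc n) i
     in (\<lambda>x. nakauchi_const l m *
          (x $ i l / norm x * v x
           - 1 / (real l + real m - 3) * (norm x * frechet_derivative v (at x) (axis (i l) 1)))))"

text \<open>The target space of dimension \<open>m ^ l\<close> is \<open>real ^ 'k\<close>, where \<open>idx\<close> is meant to be a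
  bijection from \<open>'k\<close> onto the multi-indices \<open>{1..l} \<rightarrow>\<^sub>E UNIV\<close>.\<close>

definition nakauchi_map ::
  "('k::finite \<Rightarrow> nat \<Rightarrow> 'm::finite) \<Rightarrow> nat \<Rightarrow> real ^ 'm \<Rightarrow> real ^ 'k" where
  "nakauchi_map idx l x = (\<chi> k. nakauchi_comp l (idx k) x)"

end

theory Submission
  imports Defs
begin

text \<open>
  Nakauchi's maps come from harmonic functions. Put \<open>p = n + m - 2\<close> and let \<open>v\<close> be a component
  of \<open>u\<^sup>(\<^sup>n\<^sup>)\<close>. The Kelvin-type function \<open>K = r\<^bsup>-p\<^esup> v\<close> is harmonic, so its partial
  derivatives are harmonic too, and \<open>-1/p\<close> times \<open>\<partial>\<^sub>e K\<close> is exactly \<open>r\<^bsup>-(p+1)\<^esup>\<close> times the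
  expression in the recursion for \<open>u\<^sup>(\<^sup>n\<^sup>+\<^sup>1\<^sup>)\<close>. For functions that are homogeneous of degree 0,
  harmonicity of \<open>r\<^bsup>-(l+m-2)\<^esup> u\<close> is the eigenvalue equation \<open>\<Delta>u = - (l (l+m-2) / r\<^sup>2) u\<close>
  (lemma \<open>laplacian_inverse_norm_power_mult\<close>), so every component of \<open>u\<^sup>(\<^sup>l\<^sup>)\<close> satisfies
  it. This needs commuting partial derivatives (lemma \<open>dir_deriv_commute\<close>).

  That \<open>u\<^sup>(\<^sup>l\<^sup>)\<close> has norm 1 follows by induction: summing the squares of the recursion over the
  new index gives \<open>|v|\<^sup>2 + r\<^sup>2 |\<nabla>v|\<^sup>2 / p\<^sup>2\<close>, because the mixed term is a radial derivative.
  Differentiating \<open>|u|\<^sup>2 = 1\<close> twice and using the eigenvalue equation gives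
  \<open>|\<nabla>u|\<^sup>2 = l (l+m-2) / r\<^sup>2\<close>, and the constants are chosen so that the result is 1 again.

  The map \<open>q = (s u, c)\<close> with \<open>s = sin \<alpha>\<close>, \<open>c = cos \<alpha>\<close> goes into a small sphere with
  unit conormal \<open>\<nu> = (- c u, s)\<close>. With \<open>\<mu> = l (l+m-2)\<close>, its tension field is
  \<open>f \<nu>\<close> with \<open>f = \<mu> s c / r\<^sup>2\<close>, which never vanishes: \<open>q\<close> is not harmonic. Since \<open>f\<close> is
  radial and \<open>u\<close> is constant along rays, the rough Laplacian of \<open>f \<nu>\<close> is
  \<open>(\<Delta>f - c\<^sup>2 \<mu> f / r\<^sup>2) \<nu>\<close>, and the curvature term is \<open>(s\<^sup>2 \<mu> f / r\<^sup>2) \<nu>\<close>. From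
  \<open>\<Delta> r\<^sup>-\<^sup>2 = 2 (4 - m) r\<^sup>-\<^sup>4\<close>, the bitension field is a nonzero multiple of
  \<open>(2 (4 - m) + \<mu> (2 s\<^sup>2 - 1)) \<nu>\<close> (lemma \<open>bitension_lift\<close>), which vanishes precisely for the
  stated value of \<open>sin\<^sup>2 \<alpha>\<close>.
\<close>

section \<open>Smooth maps form an algebra closed under differentiation\<close>

abbreviation dir_deriv ::
  "'a::real_normed_vector \<Rightarrow> ('a \<Rightarrow> 'b::real_normed_vector) \<Rightarrow> 'a \<Rightarrow> 'b" where
  "dir_deriv v f \<equiv> (\<lambda>x. frechet_derivative f (at x) v)"

lemma dir_deriv_cong:
  assumes "open S" "x \<in> S" "f differentiable (at x)" "\<And>y. y \<in> S \<Longrightarrow> f y = g y"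
  shows "dir_deriv v f x = dir_deriv v g x"
  using frechet_derivative_transform_within_open[OF assms(3,1,2,4)] by simp

lemma dir_deriv_eqI: "(f has_derivative f') (at x) \<Longrightarrow> dir_deriv v f x = f' v"
  by (drule frechet_derivative_at) simp

lemma Ck_on_Suc_imp: "Ck_on (Suc k) S f \<Longrightarrow> Ck_on k S f"
proof (induction k arbitrary: f)
  case 0
  then show ?case by (simp add: differentiable_imp_continuous_on)
next
  case (Suc k)
  have "f differentiable_on S" and "Ck_on (Suc k) S (dir_deriv v f)" for v
    using Suc.prems unfolding Ck_on.simps(2)[of "Suc k"] by blast+
  then show ?case
    using Suc.IH unfolding Ck_on.simps(2)[of k S f] by blast
qed

lemma Ck_on_cong:
  assumes "open S" "Ck_on k S f" "\<And>x. x \<in> S \<Longrightarrow> f x = g x"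
  shows "Ck_on k S g"
  using assms(2,3)
proof (induction k arbitrary: f g)
  case 0
  then have "continuous_on S f" "\<And>x. x \<in> S \<Longrightarrow> f x = g x" by simp_all
  then show ?case using continuous_on_cong[of S S f g] by (simp only: Ck_on.simps(1))
next
  case (Suc k)
  have df: "f differentiable (at x)" if "x \<in> S" for x
    using Suc.prems(1) that differentiable_on_eq_differentiable_at[OF assms(1)] unfolding Ck_on.simps by blast
  have "g differentiable (at x)" if "x \<in> S" for x
    using df[OF that] has_derivative_transform_within_open[of f _ x UNIV, OF _ assms(1) that Suc.prems(2)]
    unfolding differentiable_def by blast
  then have "g differentiable_on S"
    by (rule differentiable_at_imp_differentiable_on)
  moreover have "Ck_on k S (dir_deriv v g)" for v
  proof (rule Suc.IH[of "dir_deriv v f"])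
    show "Ck_on k S (dir_deriv v f)"
      using Suc.prems(1) unfolding Ck_on.simps by blast
    show "dir_deriv v f x = dir_deriv v g x" if "x \<in> S" for x
      by (rule dir_deriv_cong[OF assms(1) that df[OF that] Suc.prems(2)])
  qed
  ultimately show ?case unfolding Ck_on.simps by blast
qed

text \<open>The form in which smoothness is proved: a formula for the derivative on \<open>S\<close>, whose
  \<open>k\<close>-fold differentiability is already known, may replace \<open>frechet_derivative\<close>.\<close>

lemma Ck_on_SucI:
  assumes "open S"
    and "\<And>x. x \<in> S \<Longrightarrow> (f has_derivative (\<lambda>v. f' v x)) (at x)"
    and "\<And>v. Ck_on k S (f' v)"
  shows "Ck_on (Suc k) S f"
proof -
  have "f differentiable (at x)" if "x \<in> S" for x
    using assms(2)[OF that] unfolding differentiable_def by blast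
  then have "f differentiable_on S"
    by (rule differentiable_at_imp_differentiable_on)
  moreover have "Ck_on k S (dir_deriv v f)" for v
    using dir_deriv_eqI[OF assms(2), symmetric] by (rule Ck_on_cong[OF assms(1) assms(3)[of v]])
  ultimately show ?thesis unfolding Ck_on.simps by blast
qed

lemma Ck_on_Suc_has_derivative:
  assumes "open S" "Ck_on (Suc k) S f" "x \<in> S"
  shows "(f has_derivative (\<lambda>v. dir_deriv v f x)) (at x)"
proof -
  have "f differentiable (at x)"
    using assms(2,3) differentiable_on_eq_differentiable_at[OF assms(1)] unfolding Ck_on.simps by blast
  then show ?thesis
    unfolding frechet_derivative_works .
qed

lemma Ck_on_const: "open S \<Longrightarrow> Ck_on k S (\<lambda>x. c)"
  by (induction k arbitrary: c) auto

lemma Ck_on_bounded_linear: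
  assumes "open S" "bounded_linear h" "Ck_on k S f"
  shows "Ck_on k S (\<lambda>x. h (f x))"
  using assms(3)
proof (induction k arbitrary: f)
  case 0
  then show ?case using assms(2) by (simp add: bounded_linear.continuous_on)
next
  case (Suc k)
  show ?case
  proof (rule Ck_on_SucI[OF assms(1), where f' = "\<lambda>v x. h (dir_deriv v f x)"])
    show "((\<lambda>x. h (f x)) has_derivative (\<lambda>v. h (dir_deriv v f x))) (at x)" if "x \<in> S" for x
      using bounded_linear.has_derivative[OF assms(2)] Ck_on_Suc_has_derivative[OF assms(1) Suc.prems that]
      by blast
    show "Ck_on k S (\<lambda>x. h (dir_deriv v f x))" for v
      using Suc.prems by (intro Suc.IH) simp
  qed
qed

lemma Ck_on_add:
  assumes "open S" "Ck_on k S f" "Ck_on k S g"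
  shows "Ck_on k S (\<lambda>x. f x + g x)"
  using assms(2,3)
proof (induction k arbitrary: f g)
  case 0
  then show ?case by (simp add: continuous_on_add)
next
  case (Suc k)
  show ?case
  proof (rule Ck_on_SucI[OF assms(1), where f' = "\<lambda>v x. dir_deriv v f x + dir_deriv v g x"])
    show "((\<lambda>x. f x + g x) has_derivative (\<lambda>v. dir_deriv v f x + dir_deriv v g x)) (at x)"
      if "x \<in> S" for x
      using has_derivative_add Ck_on_Suc_has_derivative[OF assms(1) Suc.prems(1) that]
        Ck_on_Suc_has_derivative[OF assms(1) Suc.prems(2) that] by blast
    show "Ck_on k S (\<lambda>x. dir_deriv v f x + dir_deriv v g x)" for v
      using Suc.prems by (intro Suc.IH) simp_all
  qed
qed

lemma Ck_on_bounded_bilinear: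
  assumes "open S" "bounded_bilinear p" "Ck_on k S f" "Ck_on k S g"
  shows "Ck_on k S (\<lambda>x. p (f x) (g x))"
  using assms(3,4)
proof (induction k arbitrary: f g)
  case 0
  then show ?case using bounded_bilinear.continuous_on[OF assms(2)] by simp
next
  case (Suc k)
  show ?case
  proof (rule Ck_on_SucI[OF assms(1), where f' = "\<lambda>v x. p (f x) (dir_deriv v g x) + p (dir_deriv v f x) (g x)"])
    show "((\<lambda>x. p (f x) (g x)) has_derivative
        (\<lambda>v. p (f x) (dir_deriv v g x) + p (dir_deriv v f x) (g x))) (at x)" if "x \<in> S" for x
      by (rule bounded_bilinear.FDERIV[OF assms(2) Ck_on_Suc_has_derivative[OF assms(1) Suc.prems(1) that]
            Ck_on_Suc_has_derivative[OF assms(1) Suc.prems(2) that]])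
    show "Ck_on k S (\<lambda>x. p (f x) (dir_deriv v g x) + p (dir_deriv v f x) (g x))" for v
      using Suc.prems Ck_on_Suc_imp[OF Suc.prems(1)] Ck_on_Suc_imp[OF Suc.prems(2)]
      by (intro Ck_on_add[OF assms(1)] Suc.IH) simp_all
  qed
qed

lemma Ck_on_ident: "open S \<Longrightarrow> Ck_on k S (\<lambda>x. x)"
  by (cases k) (auto simp: Ck_on_const)

lemma inner_self_inverse_norm: "(x::'a::real_inner) \<noteq> 0 \<Longrightarrow> (x \<bullet> x) * (1 / norm x) ^ 2 = 1"
  by (simp add: power2_norm_eq_inner[symmetric] power_divide)

lemma has_derivative_inverse_norm:
  fixes x :: "'a::euclidean_space"
  assumes "x \<noteq> 0"
  shows "((\<lambda>x. 1 / norm x) has_derivative (\<lambda>v. - (x \<bullet> v) * (1 / norm x) ^ 3)) (at x)"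
proof -
  have "((\<lambda>x. inverse (norm x)) has_derivative
      (\<lambda>v. - (inverse (norm x) * (v \<bullet> sgn x) * inverse (norm x)))) (at x)"
    using assms by (intro Deriv.has_derivative_inverse has_derivative_norm has_derivative_ident) simp_all
  then show ?thesis
    using assms by (simp add: inverse_eq_divide sgn_div_norm power3_eq_cube inner_commute)
qed

text \<open>The derivative of \<open>1 / r\<close> in direction \<open>v\<close> is \<open>- (x \<bullet> v) (1 / r)\<^sup>3\<close>, again a polynomial in
  \<open>x\<close> and \<open>1 / r\<close>, so the order of differentiability climbs by induction.\<close>

lemma Ck_on_inverse_norm:
  fixes S :: "'a::euclidean_space set"
  assumes "open S" "0 \<notin> S"
  shows "Ck_on k S (\<lambda>x. 1 / norm x)"
proof (induction k)
  case 0
  then show ?case using assms by (auto intro!: continuous_intros)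
next
  case (Suc k)
  have *: "Ck_on k S (\<lambda>x. - (x \<bullet> v) * (1 / norm x) ^ 3)" for v
    unfolding power3_eq_cube
    by (intro Ck_on_bounded_bilinear[OF assms(1) bounded_bilinear_mult] Suc
        Ck_on_bounded_linear[OF assms(1) bounded_linear_minus[OF bounded_linear_ident]]
        Ck_on_bounded_linear[OF assms(1) bounded_linear_inner_left] Ck_on_ident assms(1))
  show ?case
    by (rule Ck_on_SucI[OF assms(1) has_derivative_inverse_norm *]) (use assms(2) in auto)
qed

lemma smooth_map_on_cong:
  "open S \<Longrightarrow> smooth_map_on S f \<Longrightarrow> (\<And>x. x \<in> S \<Longrightarrow> f x = g x) \<Longrightarrow> smooth_map_on S g"
  unfolding smooth_map_on_def using Ck_on_cong by blast

lemma smooth_map_on_const: "open S \<Longrightarrow> smooth_map_on S (\<lambda>x. c)"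
  by (simp add: smooth_map_on_def Ck_on_const)

lemma smooth_map_on_ident: "open S \<Longrightarrow> smooth_map_on S (\<lambda>x. x)"
  by (simp add: smooth_map_on_def Ck_on_ident)

lemma smooth_map_on_inverse_norm:
  "open S \<Longrightarrow> 0 \<notin> S \<Longrightarrow> smooth_map_on S (\<lambda>x. 1 / norm x)"
  by (simp add: smooth_map_on_def Ck_on_inverse_norm del: divide_eq_0_iff)

lemma smooth_map_on_bounded_linear:
  "open S \<Longrightarrow> bounded_linear h \<Longrightarrow> smooth_map_on S f \<Longrightarrow> smooth_map_on S (\<lambda>x. h (f x))"
  by (simp add: smooth_map_on_def Ck_on_bounded_linear)

lemma smooth_map_on_bounded_bilinear:
  "open S \<Longrightarrow> bounded_bilinear p \<Longrightarrow> smooth_map_on S f \<Longrightarrow> smooth_map_on S g \<Longrightarrow>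
    smooth_map_on S (\<lambda>x. p (f x) (g x))"
  by (simp add: smooth_map_on_def Ck_on_bounded_bilinear)

lemma smooth_map_on_add:
  "open S \<Longrightarrow> smooth_map_on S f \<Longrightarrow> smooth_map_on S g \<Longrightarrow> smooth_map_on S (\<lambda>x. f x + g x)"
  by (simp add: smooth_map_on_def Ck_on_add)

lemmas smooth_map_on_mult = smooth_map_on_bounded_bilinear[OF _ bounded_bilinear_mult]
lemmas smooth_map_on_scaleR = smooth_map_on_bounded_bilinear[OF _ bounded_bilinear_scaleR]

lemma smooth_map_on_minus: "open S \<Longrightarrow> smooth_map_on S f \<Longrightarrow> smooth_map_on S (\<lambda>x. - f x)"
  using smooth_map_on_bounded_linear[OF _ bounded_linear_minus[OF bounded_linear_ident]] by blast

lemma smooth_map_on_diff: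
  "open S \<Longrightarrow> smooth_map_on S f \<Longrightarrow> smooth_map_on S g \<Longrightarrow> smooth_map_on S (\<lambda>x. f x - g x)"
  using smooth_map_on_add[of S f "\<lambda>x. - g x"] by (simp add: smooth_map_on_minus)

lemma smooth_map_on_power:
  fixes f :: "_ \<Rightarrow> real"
  shows "open S \<Longrightarrow> smooth_map_on S f \<Longrightarrow> smooth_map_on S (\<lambda>x. f x ^ n)"
  by (induction n) (simp_all add: smooth_map_on_const smooth_map_on_mult)

lemma smooth_map_on_sum:
  assumes "open S" "\<And>i. i \<in> I \<Longrightarrow> smooth_map_on S (f i)"
  shows "smooth_map_on S (\<lambda>x. \<Sum>i\<in>I. f i x)"
  using assms(2)
  by (induction I rule: infinite_finite_induct)
    (simp_all add: smooth_map_on_const smooth_map_on_add assms(1))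

lemma smooth_map_on_dir_deriv: "smooth_map_on S f \<Longrightarrow> smooth_map_on S (dir_deriv v f)"
  unfolding smooth_map_on_def using Ck_on.simps(2) by blast

lemma smooth_map_on_has_derivative:
  assumes "open S" "smooth_map_on S f" "x \<in> S"
  shows "(f has_derivative (\<lambda>v. dir_deriv v f x)) (at x)"
  using assms(2) Ck_on_Suc_has_derivative[OF assms(1) _ assms(3)] unfolding smooth_map_on_def by blast

lemma smooth_map_on_differentiable:
  "open S \<Longrightarrow> smooth_map_on S f \<Longrightarrow> x \<in> S \<Longrightarrow> f differentiable (at x)"
  using smooth_map_on_has_derivative differentiable_def by blast

lemma dir_deriv_add:
  assumes "open S" "smooth_map_on S f" "smooth_map_on S g" "x \<in> S"
  shows "dir_deriv v (\<lambda>x. f x + g x) x = dir_deriv v f x + dir_deriv v g x"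
  by (rule dir_deriv_eqI[OF has_derivative_add]; intro smooth_map_on_has_derivative[OF assms(1)] assms)

lemma dir_deriv_bounded_bilinear:
  assumes "open S" "bounded_bilinear p" "smooth_map_on S f" "smooth_map_on S g" "x \<in> S"
  shows "dir_deriv v (\<lambda>x. p (f x) (g x)) x = p (f x) (dir_deriv v g x) + p (dir_deriv v f x) (g x)"
  by (rule dir_deriv_eqI[OF bounded_bilinear.FDERIV[OF assms(2)]];
      intro smooth_map_on_has_derivative[OF assms(1)] assms)

lemmas dir_deriv_mult = dir_deriv_bounded_bilinear[OF _ bounded_bilinear_mult]
lemmas dir_deriv_scaleR = dir_deriv_bounded_bilinear[OF _ bounded_bilinear_scaleR]
lemmas dir_deriv_inner = dir_deriv_bounded_bilinear[OF _ bounded_bilinear_inner]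

lemma dir_deriv_bounded_linear:
  assumes "open S" "bounded_linear h" "smooth_map_on S f" "x \<in> S"
  shows "dir_deriv v (\<lambda>x. h (f x)) x = h (dir_deriv v f x)"
  by (rule dir_deriv_eqI[OF bounded_linear.has_derivative[OF assms(2)]])
    (intro smooth_map_on_has_derivative[OF assms(1)] assms)

lemma dir_deriv_sum:
  assumes "open S" "\<And>i. i \<in> I \<Longrightarrow> smooth_map_on S (f i)" "x \<in> S"
  shows "dir_deriv v (\<lambda>x. \<Sum>i\<in>I. f i x) x = (\<Sum>i\<in>I. dir_deriv v (f i) x)"
  by (rule dir_deriv_eqI[OF has_derivative_sum]) (intro smooth_map_on_has_derivative[OF assms(1)] assms)

lemma dir_deriv_linear:
  assumes "open S" "smooth_map_on S f" "x \<in> S"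
  shows "linear (\<lambda>v. dir_deriv v f x)"
  using smooth_map_on_has_derivative[OF assms] has_derivative_linear by blast

lemma dir_deriv_eq_sum_Basis:
  fixes f :: "'a::euclidean_space \<Rightarrow> 'b::real_normed_vector"
  assumes "open S" "smooth_map_on S f" "x \<in> S"
  shows "dir_deriv v f x = (\<Sum>e\<in>Basis. (v \<bullet> e) *\<^sub>R dir_deriv e f x)"
proof -
  have "dir_deriv v f x = dir_deriv (\<Sum>e\<in>Basis. (v \<bullet> e) *\<^sub>R e) f x"
    by (simp add: euclidean_representation)
  also have "\<dots> = (\<Sum>e\<in>Basis. (v \<bullet> e) *\<^sub>R dir_deriv e f x)"
    using dir_deriv_linear[OF assms] by (simp add: linear_sum linear_cmul)
  finally show ?thesis .
qed

section \<open>Mixed partial derivatives\<close>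

text \<open>The mean value theorem, applied first along \<open>v\<close> and then along \<open>w\<close>. The left-hand side is
  symmetric in \<open>v\<close> and \<open>w\<close>, which is what makes mixed derivatives commute.\<close>

lemma second_difference_eq:
  fixes f :: "'a::euclidean_space \<Rightarrow> real"
  assumes S: "open S" and f: "smooth_map_on S f" and "0 < h"
    and seg: "\<And>s t. 0 \<le> s \<Longrightarrow> s \<le> h \<Longrightarrow> 0 \<le> t \<Longrightarrow> t \<le> h \<Longrightarrow> x + s *\<^sub>R v + t *\<^sub>R w \<in> S"
  shows "\<exists>s t. 0 < s \<and> s < h \<and> 0 < t \<and> t < h \<and>
    f (x + h *\<^sub>R v + h *\<^sub>R w) - f (x + h *\<^sub>R v) - f (x + h *\<^sub>R w) + f x
      = h * (h * dir_deriv w (dir_deriv v f) (x + s *\<^sub>R v + t *\<^sub>R w))"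
proof -
  have along: "((\<lambda>s. g (a + s *\<^sub>R b)) has_real_derivative dir_deriv b g (a + s *\<^sub>R b)) (at s)"
    if "smooth_map_on S g" "a + s *\<^sub>R b \<in> S" for g :: "'a \<Rightarrow> real" and a b s
  proof -
    have "((\<lambda>s. g (a + s *\<^sub>R b)) has_derivative (\<lambda>t. dir_deriv (t *\<^sub>R b) g (a + s *\<^sub>R b))) (at s)"
      by (rule has_derivative_compose[of "\<lambda>s. a + s *\<^sub>R b" "\<lambda>t. t *\<^sub>R b",
            OF _ smooth_map_on_has_derivative[OF S that]])
        (auto intro!: derivative_eq_intros)
    then show ?thesis
      using dir_deriv_linear[OF S that]
      by (simp add: linear_cmul has_field_derivative_def mult.commute[of _ "dir_deriv b g _"])
  qed
  define F where "F s = f (x + h *\<^sub>R w + s *\<^sub>R v) - f (x + s *\<^sub>R v)" for s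
  have F: "(F has_real_derivative dir_deriv v f (x + h *\<^sub>R w + s *\<^sub>R v) - dir_deriv v f (x + s *\<^sub>R v)) (at s)"
    if "0 \<le> s" "s \<le> h" for s
    unfolding F_def using seg[of s h] seg[of s 0] that \<open>0 < h\<close>
    by (intro DERIV_diff along f) (simp_all add: algebra_simps)
  obtain s where s: "0 < s" "s < h"
      "F h - F 0 = (h - 0) * (dir_deriv v f (x + h *\<^sub>R w + s *\<^sub>R v) - dir_deriv v f (x + s *\<^sub>R v))"
    using MVT2[OF \<open>0 < h\<close> F] by blast
  have G: "((\<lambda>t. dir_deriv v f (x + s *\<^sub>R v + t *\<^sub>R w)) has_real_derivative
      dir_deriv w (dir_deriv v f) (x + s *\<^sub>R v + t *\<^sub>R w)) (at t)" if "0 \<le> t" "t \<le> h" for t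
    using seg[of s t] that s by (intro along smooth_map_on_dir_deriv f) simp
  obtain t where t: "0 < t" "t < h"
      "dir_deriv v f (x + s *\<^sub>R v + h *\<^sub>R w) - dir_deriv v f (x + s *\<^sub>R v + 0 *\<^sub>R w)
        = (h - 0) * dir_deriv w (dir_deriv v f) (x + s *\<^sub>R v + t *\<^sub>R w)"
    using MVT2[OF \<open>0 < h\<close> G] by blast
  have "f (x + h *\<^sub>R v + h *\<^sub>R w) - f (x + h *\<^sub>R v) - f (x + h *\<^sub>R w) + f x = F h - F 0"
    by (simp add: F_def algebra_simps)
  also have "\<dots> = h * (h * dir_deriv w (dir_deriv v f) (x + s *\<^sub>R v + t *\<^sub>R w))"
    using s(3) t(3) by (simp add: add.commute add.left_commute)
  finally show ?thesis
    using s t by blast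
qed

text \<open>If the two mixed derivatives differed at \<open>x\<close>, then by continuity their values on a whole
  neighbourhood of \<open>x\<close> would be separated; the symmetric second difference of a small
  parallelogram is, up to \<open>h\<^sup>2\<close>, a value of both.\<close>

lemma dir_deriv_commute:
  fixes f :: "'a::euclidean_space \<Rightarrow> real"
  assumes S: "open S" and f: "smooth_map_on S f" and x: "x \<in> S"
  shows "dir_deriv v (dir_deriv w f) x = dir_deriv w (dir_deriv v f) x"
proof (rule ccontr)
  define A where "A = dir_deriv w (dir_deriv v f)"
  define B where "B = dir_deriv v (dir_deriv w f)"
  assume "\<not> ?thesis"
  then have pos: "0 < \<bar>A x - B x\<bar> / 2"
    by (simp add: A_def B_def)
  have cont: "isCont A x" "isCont B x"
    using smooth_map_on_has_derivative[OF S _ x] smooth_map_on_dir_deriv f has_derivative_continuous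
    unfolding A_def B_def by blast+
  obtain d where d: "0 < d" "\<And>y. norm (y - x) < d \<Longrightarrow> norm (A y - A x) < \<bar>A x - B x\<bar> / 2"
      "\<And>y. norm (y - x) < d \<Longrightarrow> norm (B y - B x) < \<bar>A x - B x\<bar> / 2"
      "\<And>y. norm (y - x) < d \<Longrightarrow> y \<in> S"
  proof -
    obtain a where a: "0 < a" "\<And>y. norm (y - x) < a \<Longrightarrow> norm (A y - A x) < \<bar>A x - B x\<bar> / 2"
      using cont(1) pos unfolding continuous_at_eps_delta dist_norm by blast
    obtain b where b: "0 < b" "\<And>y. norm (y - x) < b \<Longrightarrow> norm (B y - B x) < \<bar>A x - B x\<bar> / 2"
      using cont(2) pos unfolding continuous_at_eps_delta dist_norm by blast
    obtain c where c: "0 < c" "\<And>y. norm (y - x) < c \<Longrightarrow> y \<in> S"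
      using S x unfolding open_dist dist_norm by blast
    show ?thesis
      by (rule that[of "min a (min b c)"]) (use a b c in auto)
  qed
  \<comment> \<open>With this side length the parallelogram spanned by \<open>h v\<close> and \<open>h w\<close> stays within distance \<open>d\<close>.\<close>
  define h where "h = d / (norm v + norm w + 1)"
  have N: "0 < norm v + norm w + 1"
    by (smt (verit) norm_ge_zero)
  then have h: "0 < h" "h * (norm v + norm w) < d"
    using d(1) by (simp_all add: h_def field_simps)
  have near: "norm (x + s *\<^sub>R v + t *\<^sub>R w - x) < d" if "0 \<le> s" "s \<le> h" "0 \<le> t" "t \<le> h" for s t
  proof -
    have "norm (s *\<^sub>R v + t *\<^sub>R w) \<le> s * norm v + t * norm w"
      using norm_triangle_ineq[of "s *\<^sub>R v" "t *\<^sub>R w"] that by simp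
    also have "\<dots> \<le> h * norm v + h * norm w"
      using that by (intro add_mono mult_right_mono) auto
    also have "\<dots> < d"
      using h(2) by (simp add: algebra_simps)
    finally show ?thesis by (simp add: algebra_simps)
  qed
  have near': "norm (x + s *\<^sub>R w + t *\<^sub>R v - x) < d" if "0 \<le> s" "s \<le> h" "0 \<le> t" "t \<le> h" for s t
    using near[OF that(3,4,1,2)] by (simp add: algebra_simps)
  obtain s t where st: "0 < s" "s < h" "0 < t" "t < h"
      "f (x + h *\<^sub>R v + h *\<^sub>R w) - f (x + h *\<^sub>R v) - f (x + h *\<^sub>R w) + f x
        = h * (h * A (x + s *\<^sub>R v + t *\<^sub>R w))"
    using second_difference_eq[OF S f h(1), of x v w] d(4)[OF near] unfolding A_def by blast
  obtain s' t' where st': "0 < s'" "s' < h" "0 < t'" "t' < h"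
      "f (x + h *\<^sub>R w + h *\<^sub>R v) - f (x + h *\<^sub>R w) - f (x + h *\<^sub>R v) + f x
        = h * (h * B (x + s' *\<^sub>R w + t' *\<^sub>R v))"
    using second_difference_eq[OF S f h(1), of x w v] d(4)[OF near'] unfolding B_def by blast
  have swap: "x + h *\<^sub>R w + h *\<^sub>R v = x + h *\<^sub>R v + h *\<^sub>R w"
    by (simp add: algebra_simps)
  have "h * (h * A (x + s *\<^sub>R v + t *\<^sub>R w)) = h * (h * B (x + s' *\<^sub>R w + t' *\<^sub>R v))"
    using st(5) st'(5) unfolding swap by linarith
  then have "A (x + s *\<^sub>R v + t *\<^sub>R w) = B (x + s' *\<^sub>R w + t' *\<^sub>R v)"
    using h(1) by simp
  moreover have "norm (A (x + s *\<^sub>R v + t *\<^sub>R w) - A x) < \<bar>A x - B x\<bar> / 2"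
    using st by (intro d(2) near) auto
  moreover have "norm (B (x + s' *\<^sub>R w + t' *\<^sub>R v) - B x) < \<bar>A x - B x\<bar> / 2"
    using st' by (intro d(3) near') auto
  ultimately show False
    by (simp add: abs_if split: if_splits)
qed

section \<open>The Laplacian and radial factors\<close>

definition laplacian :: "('a::euclidean_space \<Rightarrow> 'b::real_normed_vector) \<Rightarrow> 'a \<Rightarrow> 'b" where
  "laplacian f x = (\<Sum>e\<in>Basis. dir_deriv e (dir_deriv e f) x)"

lemma laplacian_cong:
  assumes "open S" "smooth_map_on S f" "\<And>y. y \<in> S \<Longrightarrow> f y = g y" "x \<in> S"
  shows "laplacian f x = laplacian g x"
proof -
  have "dir_deriv e (dir_deriv e f) x = dir_deriv e (dir_deriv e g) x" for e
  proof (rule dir_deriv_cong[OF assms(1,4)])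
    show "dir_deriv e f differentiable (at x)"
      by (intro smooth_map_on_differentiable[OF assms(1) _ assms(4)] smooth_map_on_dir_deriv assms(2))
    show "dir_deriv e f y = dir_deriv e g y" if "y \<in> S" for y
      by (rule dir_deriv_cong[OF assms(1) that smooth_map_on_differentiable[OF assms(1,2) that] assms(3)])
  qed
  then show ?thesis by (simp only: laplacian_def)
qed

lemma smooth_map_on_laplacian:
  assumes "open S" "smooth_map_on S f"
  shows "smooth_map_on S (laplacian f)"
  unfolding laplacian_def by (intro smooth_map_on_sum smooth_map_on_dir_deriv assms)

lemma laplacian_bounded_linear:
  assumes "open S" "bounded_linear h" "smooth_map_on S f" "x \<in> S"
  shows "laplacian (\<lambda>x. h (f x)) x = h (laplacian f x)"
proof -
  have sm: "smooth_map_on S (dir_deriv e f)" for e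
    using assms(3) by (rule smooth_map_on_dir_deriv)
  have "dir_deriv e (dir_deriv e (\<lambda>x. h (f x))) x = h (dir_deriv e (dir_deriv e f) x)" for e
  proof -
    have "dir_deriv e (\<lambda>y. h (dir_deriv e f y)) x = dir_deriv e (dir_deriv e (\<lambda>x. h (f x))) x"
      using dir_deriv_bounded_linear[OF assms(1-3)]
      by (intro dir_deriv_cong[OF assms(1,4)] smooth_map_on_differentiable[OF assms(1) _ assms(4)]
          smooth_map_on_bounded_linear[OF assms(1,2)] sm) simp
    then show ?thesis
      using dir_deriv_bounded_linear[OF assms(1,2) sm assms(4)] by simp
  qed
  then show ?thesis
    by (simp only: laplacian_def linear_sum[OF bounded_linear.linear[OF assms(2)]])
qed

lemma second_dir_deriv_mult:
  fixes f g :: "'a::euclidean_space \<Rightarrow> real"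
  assumes "open S" "smooth_map_on S f" "smooth_map_on S g" "x \<in> S"
  shows "dir_deriv e (dir_deriv e (\<lambda>x. f x * g x)) x
    = dir_deriv e (dir_deriv e f) x * g x + 2 * (dir_deriv e f x * dir_deriv e g x)
      + f x * dir_deriv e (dir_deriv e g) x"
proof -
  note sm = assms(2,3) smooth_map_on_dir_deriv smooth_map_on_mult[OF assms(1)] assms(1)
  have "dir_deriv e (\<lambda>y. f y * dir_deriv e g y + dir_deriv e f y * g y) x
      = dir_deriv e (dir_deriv e (\<lambda>x. f x * g x)) x"
    using dir_deriv_mult[OF assms(1-3)]
    by (intro dir_deriv_cong[OF assms(1,4)] smooth_map_on_differentiable[OF assms(1) _ assms(4)]
          smooth_map_on_add sm) simp
  moreover have "dir_deriv e (\<lambda>y. f y * dir_deriv e g y + dir_deriv e f y * g y) x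
      = dir_deriv e (\<lambda>y. f y * dir_deriv e g y) x + dir_deriv e (\<lambda>y. dir_deriv e f y * g y) x"
    by (intro dir_deriv_add[OF assms(1)] sm assms(4))
  moreover have "dir_deriv e (\<lambda>y. f y * dir_deriv e g y) x
      = f x * dir_deriv e (dir_deriv e g) x + dir_deriv e f x * dir_deriv e g x"
    by (intro dir_deriv_mult[OF assms(1)] sm assms(4))
  moreover have "dir_deriv e (\<lambda>y. dir_deriv e f y * g y) x
      = dir_deriv e f x * dir_deriv e g x + dir_deriv e (dir_deriv e f) x * g x"
    by (intro dir_deriv_mult[OF assms(1)] sm assms(4))
  ultimately show ?thesis by simp
qed

lemma laplacian_mult:
  fixes f g :: "'a::euclidean_space \<Rightarrow> real"
  assumes "open S" "smooth_map_on S f" "smooth_map_on S g" "x \<in> S"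
  shows "laplacian (\<lambda>x. f x * g x) x
    = laplacian f x * g x + 2 * (\<Sum>e\<in>Basis. dir_deriv e f x * dir_deriv e g x) + f x * laplacian g x"
  by (simp add: laplacian_def second_dir_deriv_mult[OF assms] sum.distrib sum_distrib_left sum_distrib_right)

lemma laplacian_dir_deriv:
  fixes f :: "'a::euclidean_space \<Rightarrow> real"
  assumes S: "open S" and f: "smooth_map_on S f" and x: "x \<in> S"
  shows "laplacian (dir_deriv v f) x = dir_deriv v (laplacian f) x"
proof -
  have sm: "smooth_map_on S (dir_deriv e (dir_deriv w f))" for e w
    by (intro smooth_map_on_dir_deriv f)
  have "dir_deriv e (dir_deriv e (dir_deriv v f)) x = dir_deriv v (dir_deriv e (dir_deriv e f)) x" for e
  proof -
    have "dir_deriv e (dir_deriv e (dir_deriv v f)) x = dir_deriv e (dir_deriv v (dir_deriv e f)) x"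
      by (rule dir_deriv_cong[OF S x smooth_map_on_differentiable[OF S sm x] dir_deriv_commute[OF S f]])
    also have "\<dots> = dir_deriv v (dir_deriv e (dir_deriv e f)) x"
      by (rule dir_deriv_commute[OF S smooth_map_on_dir_deriv[OF f] x])
    finally show ?thesis .
  qed
  then have "laplacian (dir_deriv v f) x = (\<Sum>e\<in>Basis. dir_deriv v (dir_deriv e (dir_deriv e f)) x)"
    by (simp only: laplacian_def)
  also have "\<dots> = dir_deriv v (laplacian f) x"
    unfolding laplacian_def[abs_def] by (rule dir_deriv_sum[OF S sm x, symmetric])
  finally show ?thesis .
qed

lemma open_punctured: "open (UNIV - {0::'a::euclidean_space})"
  by auto

lemma smooth_map_on_inverse_norm_power:
  "smooth_map_on (UNIV - {0}) (\<lambda>x::'a::euclidean_space. (1 / norm x) ^ p)"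
  by (intro smooth_map_on_power smooth_map_on_inverse_norm) auto

lemma smooth_map_on_norm: "smooth_map_on (UNIV - {0}) (\<lambda>x::'a::euclidean_space. norm x)"
proof (rule smooth_map_on_cong[of _ "\<lambda>x. (x \<bullet> x) * (1 / norm x)"])
  show "smooth_map_on (UNIV - {0}) (\<lambda>x::'a. (x \<bullet> x) * (1 / norm x))"
    by (intro smooth_map_on_mult smooth_map_on_bounded_bilinear[OF _ bounded_bilinear_inner]
        smooth_map_on_ident smooth_map_on_inverse_norm) auto
qed (auto simp: dot_square_norm power2_eq_square)

lemma dir_deriv_inverse_norm_power:
  fixes x :: "'a::euclidean_space"
  assumes "x \<noteq> 0"
  shows "dir_deriv v (\<lambda>x. (1 / norm x) ^ p) x = - real p * (1 / norm x) ^ (p + 2) * (x \<bullet> v)"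
proof (cases p)
  case (Suc k)
  have "((\<lambda>x. (1 / norm x) ^ p) has_derivative
      (\<lambda>v. of_nat p * (- (x \<bullet> v) * (1 / norm x) ^ 3) * (1 / norm x) ^ (p - 1))) (at x)"
    by (rule has_derivative_power[OF has_derivative_inverse_norm[OF assms]])
  then have "dir_deriv v (\<lambda>x. (1 / norm x) ^ p) x
      = of_nat p * (- (x \<bullet> v) * (1 / norm x) ^ 3) * (1 / norm x) ^ (p - 1)"
    by (rule dir_deriv_eqI)
  also have "\<dots> = - real p * (1 / norm x) ^ (p + 2) * (x \<bullet> v)"
    by (simp add: Suc power3_eq_cube mult_ac del: of_nat_Suc)
  finally show ?thesis .
qed simp

lemma laplacian_inverse_norm_power:
  fixes x :: "'a::euclidean_space"
  assumes x: "x \<noteq> 0"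
  shows "laplacian (\<lambda>x. (1 / norm x) ^ p) x
    = real p * (real p + 2 - real DIM('a)) * (1 / norm x) ^ (p + 2)"
proof -
  let ?S = "UNIV - {0::'a}" and ?r = "\<lambda>x::'a. 1 / norm x"
  have xS: "x \<in> ?S"
    using x by simp
  have lin: "smooth_map_on ?S (\<lambda>y. y \<bullet> e)" for e
    by (intro smooth_map_on_bounded_linear[OF _ bounded_linear_inner_left] smooth_map_on_ident open_punctured)
  have *: "dir_deriv e (dir_deriv e (\<lambda>x. ?r x ^ p)) x
      = - real p * (?r x ^ (p + 2) * (e \<bullet> e) - real (p + 2) * ?r x ^ (p + 2 + 2) * (x \<bullet> e)\<^sup>2)" for e
  proof -
    have sm: "smooth_map_on ?S (\<lambda>y. ?r y ^ (p + 2) * (y \<bullet> e))"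
      by (intro smooth_map_on_mult smooth_map_on_inverse_norm_power lin open_punctured)
    have d: "dir_deriv e (\<lambda>y. y \<bullet> e) x = e \<bullet> e"
      by (rule dir_deriv_eqI) (auto intro!: derivative_eq_intros)
    have 1: "dir_deriv e (\<lambda>y. - real p * (?r y ^ (p + 2) * (y \<bullet> e))) x
      = dir_deriv e (dir_deriv e (\<lambda>x. ?r x ^ p)) x"
    proof (rule dir_deriv_cong[OF open_punctured xS smooth_map_on_differentiable[OF open_punctured _ xS]])
      show "smooth_map_on ?S (\<lambda>y. - real p * (?r y ^ (p + 2) * (y \<bullet> e)))"
        by (rule smooth_map_on_bounded_linear[OF open_punctured bounded_linear_mult_right sm])
      show "- real p * (?r y ^ (p + 2) * (y \<bullet> e)) = dir_deriv e (\<lambda>x. ?r x ^ p) y" if "y \<in> ?S" for y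
      proof -
        have y: "y \<noteq> 0"
          using that by simp
        show ?thesis
          using dir_deriv_inverse_norm_power[OF y, of p e] by (simp only: mult.assoc)
      qed
    qed
    have 2: "dir_deriv e (\<lambda>y. - real p * (?r y ^ (p + 2) * (y \<bullet> e))) x
      = - real p * dir_deriv e (\<lambda>y. ?r y ^ (p + 2) * (y \<bullet> e)) x"
      by (rule dir_deriv_bounded_linear[OF open_punctured bounded_linear_mult_right sm xS])
    have 3: "dir_deriv e (\<lambda>y. ?r y ^ (p + 2) * (y \<bullet> e)) x
      = ?r x ^ (p + 2) * dir_deriv e (\<lambda>y. y \<bullet> e) x + dir_deriv e (\<lambda>y. ?r y ^ (p + 2)) x * (x \<bullet> e)"
      by (rule dir_deriv_mult[OF open_punctured smooth_map_on_inverse_norm_power lin xS])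
    show ?thesis
      unfolding 1[symmetric] 2 3 d dir_deriv_inverse_norm_power[OF x, of "p + 2" e]
      by (simp only: power2_eq_square mult.assoc mult_minus_left add_uminus_conv_diff)
  qed
  have "laplacian (\<lambda>x. ?r x ^ p) x
      = (\<Sum>e\<in>Basis. - real p * (?r x ^ (p + 2) - real (p + 2) * ?r x ^ (p + 2 + 2) * (x \<bullet> e)\<^sup>2))"
    unfolding laplacian_def * by (intro sum.cong refl) (simp add: inner_Basis)
  also have "\<dots> = - real p * (real DIM('a) * ?r x ^ (p + 2) - real (p + 2) * ?r x ^ (p + 2 + 2) * (x \<bullet> x))"
    by (simp only: sum_distrib_left[symmetric] sum_subtractf sum_constant euclidean_inner[of x x] power2_eq_square)
  also have "real (p + 2) * ?r x ^ (p + 2 + 2) * (x \<bullet> x) = real (p + 2) * ?r x ^ (p + 2)"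
  proof -
    have "?r x ^ (p + 2 + 2) = ?r x ^ (p + 2) * (?r x)\<^sup>2"
      by (rule power_add)
    then have "real (p + 2) * ?r x ^ (p + 2 + 2) * (x \<bullet> x)
        = real (p + 2) * ?r x ^ (p + 2) * ((x \<bullet> x) * (?r x)\<^sup>2)"
      by (simp only: mult_ac)
    then show ?thesis
      by (simp only: inner_self_inverse_norm[OF x] mult_1_right)
  qed
  also have "- real p * (real DIM('a) * R - real (p + 2) * R) = real p * (real p + 2 - real DIM('a)) * R" for R
    by (simp add: algebra_simps)
  finally show ?thesis .
qed

lemma homogeneous_dir_deriv_radial:
  fixes u :: "'a::euclidean_space \<Rightarrow> 'b::real_normed_vector"
  assumes S: "open S" and u: "smooth_map_on S u" and x: "x \<in> S"
    and hom: "\<And>t y. 0 < t \<Longrightarrow> u (t *\<^sub>R y) = u y"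
  shows "dir_deriv x u x = 0"
proof -
  \<comment> \<open>The derivative at \<open>t = 1\<close> of \<open>u (t x)\<close>, a constant function of \<open>t > 0\<close>.\<close>
  have "((\<lambda>t. u (t *\<^sub>R x)) has_derivative (\<lambda>t. dir_deriv (t *\<^sub>R x) u x)) (at (1::real))"
    using has_derivative_compose[of "\<lambda>t. t *\<^sub>R x" "\<lambda>t. t *\<^sub>R x" "1::real" UNIV u
        "\<lambda>v. dir_deriv v u x"] smooth_map_on_has_derivative[OF S u x]
    by (simp add: has_derivative_scaleR_left)
  then have "((\<lambda>t. u x) has_derivative (\<lambda>t. dir_deriv (t *\<^sub>R x) u x)) (at (1::real))"
    by (rule has_derivative_transform_within_open[of _ _ _ _ "{0<..}"]) (auto simp: hom)
  then have "(\<lambda>t::real. dir_deriv (t *\<^sub>R x) u x) = (\<lambda>t. 0)"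
    using has_derivative_unique has_derivative_const by blast
  then show ?thesis
    by (metis scaleR_one)
qed

lemma homogeneous_dir_deriv:
  fixes u :: "'a::euclidean_space \<Rightarrow> 'b::real_normed_vector"
  assumes u: "smooth_map_on (UNIV - {0}) u" and "0 < t" and "y \<noteq> 0"
    and hom: "\<And>t y. 0 < t \<Longrightarrow> u (t *\<^sub>R y) = u y"
  shows "t *\<^sub>R dir_deriv v u (t *\<^sub>R y) = dir_deriv v u y"
proof -
  have S: "t *\<^sub>R y \<in> UNIV - {0}"
    using assms by simp
  have "((\<lambda>y. u (t *\<^sub>R y)) has_derivative (\<lambda>v. dir_deriv (t *\<^sub>R v) u (t *\<^sub>R y))) (at y)"
    by (rule has_derivative_compose[of "\<lambda>y. t *\<^sub>R y" "\<lambda>y. t *\<^sub>R y",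
          OF _ smooth_map_on_has_derivative[OF open_punctured u S]])
      (auto intro!: derivative_eq_intros)
  then have "dir_deriv v (\<lambda>y. u (t *\<^sub>R y)) y = dir_deriv (t *\<^sub>R v) u (t *\<^sub>R y)"
    by (rule dir_deriv_eqI)
  then show ?thesis
    using hom[OF assms(2)] dir_deriv_linear[OF open_punctured u S] by (simp add: linear_cmul)
qed

text \<open>The mixed term \<open>2 \<nabla>r\<^sup>-\<^sup>p \<bullet> \<nabla>u\<close> of the product rule is a multiple of the radial derivative
  of \<open>u\<close> and drops out. Thus \<open>r\<^sup>-\<^sup>p u\<close> is harmonic precisely when \<open>u\<close> is an eigenfunction of
  \<open>r\<^sup>2 \<Delta>\<close> with eigenvalue \<open>- p (p + 2 - m)\<close>.\<close>

lemma laplacian_inverse_norm_power_mult: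
  fixes u :: "'a::euclidean_space \<Rightarrow> real"
  assumes u: "smooth_map_on (UNIV - {0}) u" and x: "x \<noteq> 0" and radial: "dir_deriv x u x = 0"
  shows "laplacian (\<lambda>x. (1 / norm x) ^ p * u x) x
    = (1 / norm x) ^ p * (laplacian u x + real p * (real p + 2 - real DIM('a)) * (1 / norm x)\<^sup>2 * u x)"
proof -
  have xS: "x \<in> UNIV - {0}"
    using x by simp
  have "(\<Sum>e\<in>Basis. dir_deriv e (\<lambda>x. (1 / norm x) ^ p) x * dir_deriv e u x)
      = - real p * (1 / norm x) ^ (p + 2) * (\<Sum>e\<in>Basis. (x \<bullet> e) *\<^sub>R dir_deriv e u x)"
    unfolding dir_deriv_inverse_norm_power[OF x] by (simp only: sum_distrib_left real_scaleR_def mult_ac)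
  also have "\<dots> = 0"
    using dir_deriv_eq_sum_Basis[OF open_punctured u xS, of x] radial by simp
  finally show ?thesis
    unfolding laplacian_mult[OF open_punctured smooth_map_on_inverse_norm_power u xS]
      laplacian_inverse_norm_power[OF x]
    by (simp add: algebra_simps power_add power2_eq_square add_divide_distrib)
qed

section \<open>Raising the degree of a spherical harmonic\<close>

text \<open>The step of Nakauchi's recursion without its normalizing constant. It turns a spherical
  harmonic of degree \<open>n\<close> into one of degree \<open>n + 1\<close> when \<open>p = n + m - 2\<close>.\<close>

definition raise_degree :: "nat \<Rightarrow> 'a::euclidean_space \<Rightarrow> ('a \<Rightarrow> real) \<Rightarrow> 'a \<Rightarrow> real" where
  "raise_degree p e v x = (x \<bullet> e) / norm x * v x - 1 / real p * (norm x * dir_deriv e v x)"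

lemma smooth_map_on_inner_left: "open S \<Longrightarrow> smooth_map_on S (\<lambda>x. x \<bullet> e)"
  by (intro smooth_map_on_bounded_linear[OF _ bounded_linear_inner_left] smooth_map_on_ident)

lemma smooth_map_on_normalized_coordinate:
  "smooth_map_on (UNIV - {0}) (\<lambda>x::'a::euclidean_space. (x \<bullet> e) / norm x)"
proof -
  have "smooth_map_on (UNIV - {0}) (\<lambda>x::'a. (x \<bullet> e) * (1 / norm x))"
    by (intro smooth_map_on_mult smooth_map_on_inner_left smooth_map_on_inverse_norm) auto
  then show ?thesis
    by simp
qed

lemma smooth_map_on_raise_degree:
  assumes "smooth_map_on (UNIV - {0}) v"
  shows "smooth_map_on (UNIV - {0}) (raise_degree p e v)"
  unfolding raise_degree_def
  by (intro smooth_map_on_diff smooth_map_on_mult smooth_map_on_normalized_coordinate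
      smooth_map_on_norm smooth_map_on_const smooth_map_on_dir_deriv assms open_punctured)

text \<open>The derivative of a function of degree 0 is homogeneous of degree \<open>- 1\<close>, and the factor
  \<open>norm x\<close> makes up for it.\<close>

lemma raise_degree_homogeneous:
  assumes "smooth_map_on (UNIV - {0}) v" and hom: "\<And>t y. 0 < t \<Longrightarrow> v (t *\<^sub>R y) = v y" and "0 < t"
  shows "raise_degree p e v (t *\<^sub>R x) = raise_degree p e v x"
proof (cases "x = 0")
  case False
  have "t * dir_deriv e v (t *\<^sub>R x) = dir_deriv e v x"
    using homogeneous_dir_deriv[OF assms(1,3) False hom, of e] by simp
  then have "norm (t *\<^sub>R x) * dir_deriv e v (t *\<^sub>R x) = norm x * dir_deriv e v x"
    using \<open>0 < t\<close> by (simp add: mult.commute mult.left_commute)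
  then show ?thesis
    using \<open>0 < t\<close> by (simp add: raise_degree_def hom)
qed simp

text \<open>The recursion is differentiation in disguise: this identity explains the coefficient
  \<open>1 / p\<close> and reduces the next lemma to the fact that derivatives of harmonic functions are
  harmonic.\<close>

lemma raise_degree_eq_dir_deriv:
  fixes v :: "'a::euclidean_space \<Rightarrow> real"
  assumes v: "smooth_map_on (UNIV - {0}) v" and "0 < p" and x: "x \<noteq> 0"
  shows "(1 / norm x) ^ Suc p * raise_degree p e v x
    = - (1 / real p) * dir_deriv e (\<lambda>x. (1 / norm x) ^ p * v x) x"
proof -
  have "dir_deriv e (\<lambda>x. (1 / norm x) ^ p * v x) x
      = (1 / norm x) ^ p * dir_deriv e v x
        - real p * (1 / norm x) ^ (p + 2) * (x \<bullet> e) * v x"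
    using dir_deriv_mult[OF open_punctured smooth_map_on_inverse_norm_power v, of x]
      dir_deriv_inverse_norm_power[OF x] x by simp
  then show ?thesis
    unfolding raise_degree_def using assms(2) x
    by (simp only:) (simp add: field_simps power_divide)
qed

text \<open>By the eigenvalue equation, \<open>K = r\<^sup>-\<^sup>p v\<close> is harmonic. Hence so is \<open>\<partial>\<^sub>e K\<close>, which is a
  multiple of \<open>r\<^bsup>-(p+1)\<^esup>\<close> times the raised function; reading harmonicity back gives the
  eigenvalue equation of the next degree.\<close>

lemma laplacian_raise_degree:
  fixes v :: "'a::euclidean_space \<Rightarrow> real"
  assumes v: "smooth_map_on (UNIV - {0}) v"
    and hom: "\<And>t y. 0 < t \<Longrightarrow> v (t *\<^sub>R y) = v y"
    and eigen: "\<And>x. x \<noteq> 0 \<Longrightarrow> laplacian v x = - (real n * real p) * (1 / norm x)\<^sup>2 * v x"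
    and p: "0 < p" "p + 2 = n + DIM('a)"
    and x: "x \<noteq> 0"
  shows "laplacian (raise_degree p e v) x
    = - (real (Suc n) * real (Suc p)) * (1 / norm x)\<^sup>2 * raise_degree p e v x"
proof -
  let ?S = "UNIV - {0::'a}" and ?r = "\<lambda>x::'a. 1 / norm x"
  define w where "w = raise_degree p e v"
  define K where "K = (\<lambda>x. ?r x ^ p * v x)"
  have S: "x \<in> ?S"
    using x by simp
  have w: "smooth_map_on ?S w"
    unfolding w_def by (rule smooth_map_on_raise_degree[OF v])
  have K: "smooth_map_on ?S K"
    unfolding K_def by (intro smooth_map_on_mult smooth_map_on_inverse_norm_power v open_punctured)
  have n: "real p + 2 - real DIM('a) = real n"
    using p(2) by linarith
  have harmonic: "0 = laplacian K y" if y: "y \<in> ?S" for y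
  proof -
    have "dir_deriv y v y = 0"
      by (rule homogeneous_dir_deriv_radial[OF open_punctured v y hom])
    then have "laplacian K y
        = ?r y ^ p * (laplacian v y + real p * (real p + 2 - real DIM('a)) * (?r y)\<^sup>2 * v y)"
      unfolding K_def using y by (intro laplacian_inverse_norm_power_mult[OF v]) auto
    then show ?thesis
      using y by (simp add: n eigen)
  qed
  have "laplacian (\<lambda>x. ?r x ^ Suc p * w x) x = laplacian (\<lambda>x. - (1 / real p) * dir_deriv e K x) x"
    unfolding w_def K_def using raise_degree_eq_dir_deriv[OF v p(1)] v
    by (intro laplacian_cong[OF open_punctured _ _ S] smooth_map_on_mult
        smooth_map_on_inverse_norm_power open_punctured smooth_map_on_raise_degree) auto
  also have "\<dots> = - (1 / real p) * laplacian (dir_deriv e K) x"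
    by (rule laplacian_bounded_linear[OF open_punctured bounded_linear_mult_right _ S])
      (intro smooth_map_on_dir_deriv K)
  also have "laplacian (dir_deriv e K) x = dir_deriv e (laplacian K) x"
    by (rule laplacian_dir_deriv[OF open_punctured K S])
  also have "dir_deriv e (laplacian K) x = dir_deriv e (\<lambda>y. 0) x"
    by (rule dir_deriv_cong[OF open_punctured S smooth_map_on_differentiable[OF open_punctured
            smooth_map_on_laplacian[OF open_punctured K] S] harmonic[symmetric]])
  finally have "laplacian (\<lambda>x. ?r x ^ Suc p * w x) x = 0"
    by simp
  moreover have "dir_deriv x w x = 0"
    unfolding w_def
    by (rule homogeneous_dir_deriv_radial[OF open_punctured smooth_map_on_raise_degree[OF v] S])
      (rule raise_degree_homogeneous[OF v hom])
  ultimately have "?r x ^ Suc p * (laplacian w x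
      + real (Suc p) * (real (Suc p) + 2 - real DIM('a)) * (?r x)\<^sup>2 * w x) = 0"
    using laplacian_inverse_norm_power_mult[OF w x, of "Suc p"] by simp
  moreover have "?r x ^ Suc p \<noteq> 0"
    using x by simp
  moreover have "real (Suc p) + 2 - real DIM('a) = real (Suc n)"
    using p(2) by linarith
  ultimately have "laplacian w x + real (Suc p) * real (Suc n) * (?r x)\<^sup>2 * w x = 0"
    by (metis mult_eq_0_iff)
  then show ?thesis
    unfolding w_def
    by (simp only: eq_neg_iff_add_eq_0[symmetric] mult_minus_left
        mult.commute[of "real (Suc p)" "real (Suc n)"])
qed

text \<open>Differentiate \<open>\<Sum>\<^sub>i f\<^sub>i\<^sup>2 = 1\<close> twice. Summed over an orthonormal basis, this determines the
  energy density of a map into a sphere from its Laplacian.\<close>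

lemma sum_squares_one_derivatives:
  fixes f :: "'i \<Rightarrow> 'a::euclidean_space \<Rightarrow> real"
  assumes S: "open S" and f: "\<And>i. i \<in> I \<Longrightarrow> smooth_map_on S (f i)"
    and one: "\<And>x. x \<in> S \<Longrightarrow> (\<Sum>i\<in>I. (f i x)\<^sup>2) = 1" and x: "x \<in> S"
  shows "(\<Sum>i\<in>I. (dir_deriv e (f i) x)\<^sup>2) = - (\<Sum>i\<in>I. f i x * dir_deriv e (dir_deriv e (f i)) x)"
proof -
  note sm = smooth_map_on_mult[OF S] smooth_map_on_dir_deriv f
  have first: "0 = (\<Sum>i\<in>I. f i y * dir_deriv e (f i) y)" if y: "y \<in> S" for y
  proof -
    have "dir_deriv e (\<lambda>y. \<Sum>i\<in>I. f i y * f i y) y = dir_deriv e (\<lambda>y. 1) y"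
      using one unfolding power2_eq_square
      by (intro dir_deriv_cong[OF S y] smooth_map_on_differentiable[OF S _ y] smooth_map_on_sum sm S) auto
    moreover have "dir_deriv e (\<lambda>y. \<Sum>i\<in>I. f i y * f i y) y = (\<Sum>i\<in>I. dir_deriv e (\<lambda>y. f i y * f i y) y)"
      by (intro dir_deriv_sum[OF S _ y] sm)
    moreover have "\<dots> = (\<Sum>i\<in>I. f i y * dir_deriv e (f i) y + dir_deriv e (f i) y * f i y)"
      by (intro sum.cong refl dir_deriv_mult[OF S _ _ y] f)
    ultimately show ?thesis
      by (simp add: mult.commute sum_distrib_left[symmetric])
  qed
  have "dir_deriv e (\<lambda>y. \<Sum>i\<in>I. f i y * dir_deriv e (f i) y) x = dir_deriv e (\<lambda>y. 0) x"
    using first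
    by (intro dir_deriv_cong[OF S x] smooth_map_on_differentiable[OF S _ x] smooth_map_on_sum sm S) auto
  moreover have "dir_deriv e (\<lambda>y. \<Sum>i\<in>I. f i y * dir_deriv e (f i) y) x
      = (\<Sum>i\<in>I. dir_deriv e (\<lambda>y. f i y * dir_deriv e (f i) y) x)"
    by (intro dir_deriv_sum[OF S _ x] sm)
  moreover have "\<dots> = (\<Sum>i\<in>I. f i x * dir_deriv e (dir_deriv e (f i)) x
      + dir_deriv e (f i) x * dir_deriv e (f i) x)"
    by (intro sum.cong refl dir_deriv_mult[OF S _ _ x] sm)
  ultimately show ?thesis
    by (simp add: sum.distrib power2_eq_square)
qed

text \<open>The mixed terms add up to a multiple of the radial derivative, and the coefficients
  \<open>(x \<bullet> e) / norm x\<close> are those of a unit vector.\<close>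

lemma sum_raise_degree_squares:
  fixes v :: "'a::euclidean_space \<Rightarrow> real"
  assumes v: "smooth_map_on (UNIV - {0}) v" and x: "x \<noteq> 0" and radial: "dir_deriv x v x = 0"
  shows "(\<Sum>e\<in>Basis. (raise_degree p e v x)\<^sup>2)
    = (v x)\<^sup>2 + (norm x / real p)\<^sup>2 * (\<Sum>e\<in>Basis. (dir_deriv e v x)\<^sup>2)"
proof -
  have S: "x \<in> UNIV - {0}"
    using x by simp
  have "(\<Sum>e\<in>Basis. (x \<bullet> e) * dir_deriv e v x) = 0"
    using dir_deriv_eq_sum_Basis[OF open_punctured v S, of x] radial by simp
  moreover have "(\<Sum>e\<in>Basis. ((x \<bullet> e) / norm x)\<^sup>2) = 1"
  proof -
    have "(\<Sum>e\<in>Basis. ((x \<bullet> e) / norm x)\<^sup>2) = (\<Sum>e\<in>Basis. (x \<bullet> e) * (x \<bullet> e)) / (norm x)\<^sup>2"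
      by (simp add: power_divide sum_divide_distrib power2_eq_square)
    also have "\<dots> = 1"
      using x by (simp add: euclidean_inner[symmetric] power2_norm_eq_inner)
    finally show ?thesis .
  qed
  moreover have "(raise_degree p e v x)\<^sup>2 = (v x)\<^sup>2 * ((x \<bullet> e) / norm x)\<^sup>2
      - (2 * v x / real p) * ((x \<bullet> e) * dir_deriv e v x)
      + (norm x / real p)\<^sup>2 * (dir_deriv e v x)\<^sup>2" for e
    using x by (simp add: raise_degree_def power2_diff power_mult_distrib power_divide mult_ac)
  ultimately show ?thesis
    by (simp only: sum.distrib sum_subtractf sum_distrib_left[symmetric]
        mult_1_right mult_zero_right diff_0_right)
qed

text \<open>The unit norm and the eigenvalue equation give the energy density \<open>n p / r\<^sup>2\<close>; divided by
  \<open>p\<^sup>2 / r\<^sup>2\<close> it contributes \<open>n / p\<close>.\<close>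

lemma sum_raise_degree_squares_family:
  fixes v :: "'i \<Rightarrow> 'a::euclidean_space \<Rightarrow> real"
  assumes v: "\<And>i. i \<in> I \<Longrightarrow> smooth_map_on (UNIV - {0}) (v i)"
    and hom: "\<And>i t y. i \<in> I \<Longrightarrow> 0 < t \<Longrightarrow> v i (t *\<^sub>R y) = v i y"
    and eigen: "\<And>i x. i \<in> I \<Longrightarrow> x \<noteq> 0 \<Longrightarrow>
      laplacian (v i) x = - (real n * real p) * (1 / norm x)\<^sup>2 * v i x"
    and one: "\<And>x. x \<noteq> 0 \<Longrightarrow> (\<Sum>i\<in>I. (v i x)\<^sup>2) = 1"
    and p: "0 < p" and x: "x \<noteq> 0"
  shows "(\<Sum>i\<in>I. \<Sum>e\<in>Basis. (raise_degree p e (v i) x)\<^sup>2) = 1 + real n / real p"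
proof -
  have S: "x \<in> UNIV - {0}"
    using x by simp
  have "(\<Sum>i\<in>I. \<Sum>e\<in>Basis. (dir_deriv e (v i) x)\<^sup>2)
      = (\<Sum>e\<in>Basis. \<Sum>i\<in>I. (dir_deriv e (v i) x)\<^sup>2)"
    by (rule sum.swap)
  also have "\<dots> = - (\<Sum>e\<in>Basis. \<Sum>i\<in>I. v i x * dir_deriv e (dir_deriv e (v i)) x)"
    using sum_squares_one_derivatives[of "UNIV - {0}" I v, OF open_punctured v _ S] one
    by (simp add: sum_negf)
  also have "\<dots> = - (\<Sum>i\<in>I. v i x * laplacian (v i) x)"
    by (subst sum.swap) (simp add: laplacian_def sum_distrib_left)
  also have "\<dots> = - (\<Sum>i\<in>I. - (real n * real p) * (1 / norm x)\<^sup>2 * (v i x)\<^sup>2)"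
    using eigen x by (simp add: power2_eq_square mult_ac)
  also have "\<dots> = real n * real p * (1 / norm x)\<^sup>2"
    using one[OF x] by (simp only: sum_distrib_left[symmetric]) simp
  finally have grad: "(\<Sum>i\<in>I. \<Sum>e\<in>Basis. (dir_deriv e (v i) x)\<^sup>2) = real n * real p * (1 / norm x)\<^sup>2" .
  have "(\<Sum>i\<in>I. \<Sum>e\<in>Basis. (raise_degree p e (v i) x)\<^sup>2)
      = (\<Sum>i\<in>I. (v i x)\<^sup>2 + (norm x / real p)\<^sup>2 * (\<Sum>e\<in>Basis. (dir_deriv e (v i) x)\<^sup>2))"
    by (intro sum.cong refl sum_raise_degree_squares[OF v x]
        homogeneous_dir_deriv_radial[OF open_punctured v S hom])
  also have "\<dots> = 1 + (norm x / real p)\<^sup>2 * (real n * real p * (1 / norm x)\<^sup>2)"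
    by (simp only: sum.distrib sum_distrib_left[symmetric] one[OF x] grad)
  also have "\<dots> = 1 + real n / real p"
    using p x by (simp add: power_divide power2_eq_square)
  finally show ?thesis .
qed

section \<open>Nakauchi's maps are eigenmaps\<close>

lemma sum_axis_Basis: "(\<Sum>j\<in>UNIV. g (axis j 1 :: real ^ 'm::finite)) = (\<Sum>b\<in>Basis. g b)"
proof -
  have "(Basis :: (real ^ 'm) set) = range (\<lambda>j. axis j 1)"
    by (auto simp: Basis_vec_def)
  moreover have "sum g (range (\<lambda>j. axis j 1 :: real ^ 'm)) = (\<Sum>j\<in>UNIV. g (axis j 1))"
    by (subst sum.reindex) (auto simp: inj_on_def axis_eq_axis)
  ultimately show ?thesis
    by (simp only:)
qed

lemma nakauchi_comp_Suc_Suc: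
  fixes i :: "nat \<Rightarrow> 'm::finite"
  assumes "p + 2 = Suc n + CARD('m)"
  shows "nakauchi_comp (Suc (Suc n)) i x = nakauchi_const (Suc (Suc n)) CARD('m)
    * raise_degree p (axis (i (Suc (Suc n))) 1) (nakauchi_comp (Suc n) i) x"
proof -
  have "real (Suc (Suc n)) + real CARD('m) - 3 = real p"
    using assms by linarith
  then show ?thesis
    by (simp add: raise_degree_def Let_def inner_axis)
qed

lemma nakauchi_comp_fun_upd: "n < k \<Longrightarrow> nakauchi_comp n (i(k := j)) = nakauchi_comp n i"
proof (induction n)
  case (Suc n)
  then show ?case
    by (cases n) (simp_all add: Let_def)
qed simp

text \<open>The base of the induction is computed directly: \<open>x\<^sub>e / r\<close> would be the raising of the constant
  1, but with \<open>p = m - 2\<close>, which is 0 in the plane.\<close>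

lemma laplacian_normalized_coordinate:
  fixes x :: "'a::euclidean_space"
  assumes x: "x \<noteq> 0"
  shows "laplacian (\<lambda>x. (x \<bullet> e) / norm x) x = - (real DIM('a) - 1) * (1 / norm x)\<^sup>2 * ((x \<bullet> e) / norm x)"
proof -
  have S: "x \<in> UNIV - {0}"
    using x by simp
  have d: "dir_deriv b (\<lambda>y. y \<bullet> e) y = b \<bullet> e" for b y :: 'a
    by (rule dir_deriv_eqI) (auto intro!: derivative_eq_intros)
  have [simp]: "laplacian (\<lambda>y. y \<bullet> e) x = 0"
    by (simp add: laplacian_def d)
  have "laplacian (\<lambda>x. (x \<bullet> e) * (1 / norm x) ^ 1) x
     = 2 * (\<Sum>b\<in>Basis. (b \<bullet> e) * (- real 1 * (1 / norm x) ^ (1 + 2) * (x \<bullet> b)))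
       + (x \<bullet> e) * (real 1 * (real 1 + 2 - real DIM('a)) * (1 / norm x) ^ (1 + 2))"
    unfolding laplacian_mult[OF open_punctured smooth_map_on_inner_left[OF open_punctured]
        smooth_map_on_inverse_norm_power S] laplacian_inverse_norm_power[OF x]
      dir_deriv_inverse_norm_power[OF x] d
    by simp
  also have "(\<Sum>b\<in>Basis. (b \<bullet> e) * (- real 1 * (1 / norm x) ^ (1 + 2) * (x \<bullet> b)))
     = - ((1 / norm x) ^ (1 + 2)) * (\<Sum>b\<in>Basis. (x \<bullet> b) * (e \<bullet> b))"
    unfolding sum_distrib_left by (intro sum.cong refl) (simp add: inner_commute power3_eq_cube)
  also have "\<dots> = - ((1 / norm x) ^ (1 + 2)) * (x \<bullet> e)"
    by (simp only: euclidean_inner[of x e])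
  finally show ?thesis
    by (simp add: power3_eq_cube power2_eq_square add_divide_distrib diff_divide_distrib algebra_simps)
qed

text \<open>The three properties are proved in one induction since the eigenvalue equation in degree
  \<open>n + 1\<close> uses smoothness and homogeneity in degree \<open>n\<close>. In dimension 1 the recursion would divide
  by \<open>p = 0\<close> in its first step.\<close>

lemma nakauchi_comp_eigenfunction:
  fixes i :: "nat \<Rightarrow> 'm::finite"
  assumes m: "2 \<le> CARD('m)"
  shows "smooth_map_on (UNIV - {0}) (nakauchi_comp (Suc n) i)
    \<and> (\<forall>t x. 0 < t \<longrightarrow> nakauchi_comp (Suc n) i (t *\<^sub>R x) = nakauchi_comp (Suc n) i x)
    \<and> (\<forall>x. x \<noteq> 0 \<longrightarrow> laplacian (nakauchi_comp (Suc n) i) x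
      = - (real (Suc n) * real (n + CARD('m) - 1)) * (1 / norm x)\<^sup>2 * nakauchi_comp (Suc n) i x)"
proof (induction n)
  case 0
  have eq: "nakauchi_comp (Suc 0) i = (\<lambda>x. (x \<bullet> axis (i 1) 1) / norm x)"
    by (simp add: fun_eq_iff inner_axis)
  show ?case
    unfolding eq
    using m smooth_map_on_normalized_coordinate laplacian_normalized_coordinate[where 'a = "real ^ 'm"]
    by (simp add: of_nat_diff)
next
  case (Suc n)
  define p where "p = n + CARD('m) - 1"
  define v where "v = nakauchi_comp (Suc n) i"
  define C where "C = nakauchi_const (Suc (Suc n)) CARD('m)"
  define e :: "real ^ 'm" where "e = axis (i (Suc (Suc n))) 1"
  have p: "0 < p" "p + 2 = Suc n + CARD('m)" "Suc n + CARD('m) - 1 = Suc p"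
    using m by (simp_all add: p_def)
  have eq: "nakauchi_comp (Suc (Suc n)) i = (\<lambda>x. C * raise_degree p e v x)"
    unfolding C_def e_def v_def by (rule ext, rule nakauchi_comp_Suc_Suc[OF p(2)])
  have v: "smooth_map_on (UNIV - {0}) v"
    and hom: "\<And>t x. 0 < t \<Longrightarrow> v (t *\<^sub>R x) = v x"
    and eigen: "\<And>x. x \<noteq> 0 \<Longrightarrow> laplacian v x = - (real (Suc n) * real p) * (1 / norm x)\<^sup>2 * v x"
    using Suc.IH[folded v_def p_def] by blast+
  have w: "smooth_map_on (UNIV - {0}) (raise_degree p e v)"
    by (rule smooth_map_on_raise_degree[OF v])
  have lap: "laplacian (\<lambda>x. C * raise_degree p e v x) x
      = - (real (Suc (Suc n)) * real (Suc p)) * (1 / norm x)\<^sup>2 * (C * raise_degree p e v x)"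
    if x: "x \<noteq> 0" for x
  proof -
    have "laplacian (\<lambda>x. C * raise_degree p e v x) x = C * laplacian (raise_degree p e v) x"
      using x by (intro laplacian_bounded_linear[OF open_punctured bounded_linear_mult_right w]) simp
    also have "laplacian (raise_degree p e v) x
        = - (real (Suc (Suc n)) * real (Suc p)) * (1 / norm x)\<^sup>2 * raise_degree p e v x"
      using p(2) by (intro laplacian_raise_degree[OF v hom eigen p(1) _ x]) simp_all
    finally show ?thesis
      by (simp only: mult_ac)
  qed
  show ?case
    unfolding eq p(3)
  proof (intro conjI allI impI)
    show "smooth_map_on (UNIV - {0}) (\<lambda>x. C * raise_degree p e v x)"
      by (rule smooth_map_on_bounded_linear[OF open_punctured bounded_linear_mult_right w])
    show "C * raise_degree p e v (t *\<^sub>R x) = C * raise_degree p e v x" if "0 < t" for t x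
      by (simp only: raise_degree_homogeneous[OF v hom that])
  qed (rule lap)
qed

lemma nakauchi_const_square:
  assumes "p + 2 = n + m" "0 < p"
  shows "(nakauchi_const (Suc n) m)\<^sup>2 * (1 + real n / real p) = 1"
proof -
  have "real p + 2 = real n + real m"
    using assms(1) by linarith
  then have "real (Suc n) + real m - 3 = real p" "2 * real (Suc n) + real m - 4 = real p + real n"
    by simp_all
  then have "(nakauchi_const (Suc n) m)\<^sup>2 = real p / (real p + real n)"
    by (simp add: nakauchi_const_def)
  then show ?thesis
    using assms(2) by (simp add: field_simps)
qed

lemma sum_PiE_Suc:
  "(\<Sum>i\<in>{1..Suc n} \<rightarrow>\<^sub>E (UNIV :: 'm set). g i)
    = (\<Sum>i\<in>{1..n} \<rightarrow>\<^sub>E UNIV. \<Sum>j\<in>UNIV. g (i(Suc n := j)))"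
proof -
  have "{1..Suc n} \<rightarrow>\<^sub>E (UNIV :: 'm set)
      = (\<lambda>(j, i). i(Suc n := j)) ` (UNIV \<times> ({1..n} \<rightarrow>\<^sub>E UNIV))"
    using PiE_insert_eq[of "Suc n" "{1..n}" "\<lambda>_. UNIV"] by (simp add: atLeastAtMostSuc_conv)
  moreover have "inj_on (\<lambda>(j, i). i(Suc n := j)) (UNIV \<times> ({1..n} \<rightarrow>\<^sub>E (UNIV :: 'm set)))"
    using inj_combinator[of "Suc n" "{1..n}" "\<lambda>_. UNIV"] by simp
  ultimately have "(\<Sum>i\<in>{1..Suc n} \<rightarrow>\<^sub>E (UNIV :: 'm set). g i)
      = (\<Sum>(j, i)\<in>UNIV \<times> ({1..n} \<rightarrow>\<^sub>E UNIV). g (i(Suc n := j)))"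
    by (simp add: sum.reindex split_def comp_def)
  also have "\<dots> = (\<Sum>i\<in>{1..n} \<rightarrow>\<^sub>E UNIV. \<Sum>j\<in>UNIV. g (i(Suc n := j)))"
    unfolding sum.cartesian_product[symmetric] by (rule sum.swap)
  finally show ?thesis .
qed

text \<open>A multi-index of length \<open>n + 1\<close> is one of length \<open>n\<close> together with a last entry, and the sum over
  the last entry is the sum over the standard basis in \<open>sum_raise_degree_squares_family\<close>.\<close>

lemma sum_nakauchi_comp_squares:
  assumes m: "2 \<le> CARD('m::finite)" and x: "x \<noteq> 0"
  shows "(\<Sum>i\<in>{1..Suc n} \<rightarrow>\<^sub>E (UNIV :: 'm set). (nakauchi_comp (Suc n) i x)\<^sup>2) = 1"
  using x
proof (induction n arbitrary: x)
  case 0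
  have "(\<Sum>i\<in>{1..Suc 0} \<rightarrow>\<^sub>E (UNIV :: 'm set). (nakauchi_comp (Suc 0) i x)\<^sup>2)
      = (\<Sum>b\<in>Basis. ((x \<bullet> b) / norm x)\<^sup>2)"
    unfolding sum_PiE_Suc[of _ 0] sum_axis_Basis[symmetric] by (simp add: inner_axis)
  also have "\<dots> = (\<Sum>b\<in>Basis. (x \<bullet> b) * (x \<bullet> b)) / (norm x)\<^sup>2"
    by (simp add: power_divide sum_divide_distrib power2_eq_square)
  also have "\<dots> = 1"
    using 0 by (simp add: euclidean_inner[symmetric] power2_norm_eq_inner)
  finally show ?case .
next
  case (Suc n)
  define p where "p = n + CARD('m) - 1"
  define C where "C = nakauchi_const (Suc (Suc n)) CARD('m)"
  have p: "0 < p" "p + 2 = Suc n + CARD('m)"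
    using m by (simp_all add: p_def)
  have "(\<Sum>i\<in>{1..Suc (Suc n)} \<rightarrow>\<^sub>E (UNIV :: 'm set). (nakauchi_comp (Suc (Suc n)) i x)\<^sup>2)
      = (\<Sum>i\<in>{1..Suc n} \<rightarrow>\<^sub>E (UNIV :: 'm set). \<Sum>j\<in>UNIV.
          C\<^sup>2 * (raise_degree p (axis j 1) (nakauchi_comp (Suc n) i) x)\<^sup>2)"
    unfolding sum_PiE_Suc[of _ "Suc n"] nakauchi_comp_Suc_Suc[OF p(2)] C_def
    by (simp only: nakauchi_comp_fun_upd fun_upd_same power_mult_distrib lessI)
  also have "\<dots> = C\<^sup>2 * (\<Sum>i\<in>{1..Suc n} \<rightarrow>\<^sub>E (UNIV :: 'm set). \<Sum>b\<in>Basis.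
          (raise_degree p b (nakauchi_comp (Suc n) i) x)\<^sup>2)"
    by (simp only: sum_distrib_left[symmetric] sum_axis_Basis[symmetric])
  also have "(\<Sum>i\<in>{1..Suc n} \<rightarrow>\<^sub>E (UNIV :: 'm set). \<Sum>b\<in>Basis.
          (raise_degree p b (nakauchi_comp (Suc n) i) x)\<^sup>2) = 1 + real (Suc n) / real p"
    using nakauchi_comp_eigenfunction[OF m, of n, folded p_def] Suc.IH
    by (intro sum_raise_degree_squares_family[OF _ _ _ _ p(1) Suc.prems]) blast+
  finally show ?case
    using nakauchi_const_square[OF p(2,1)] by (simp add: C_def)
qed

section \<open>Small spheres over eigenmaps\<close>

lemma unit_map_derivatives:
  fixes u :: "'a::euclidean_space \<Rightarrow> 'b::euclidean_space"
  assumes S: "open S" and u: "smooth_map_on S u" and unit: "\<And>x. x \<in> S \<Longrightarrow> u x \<bullet> u x = 1"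
    and x: "x \<in> S"
  shows "u x \<bullet> dir_deriv e u x = 0"
    and "u x \<bullet> dir_deriv e (dir_deriv e u) x = - (dir_deriv e u x \<bullet> dir_deriv e u x)"
proof -
  have u': "smooth_map_on S (dir_deriv e u)"
    by (rule smooth_map_on_dir_deriv[OF u])
  have first: "u x \<bullet> dir_deriv e u x = 0" if x: "x \<in> S" for x
  proof -
    have "dir_deriv e (\<lambda>y. u y \<bullet> u y) x = dir_deriv e (\<lambda>y. 1) x"
      by (rule dir_deriv_cong[OF S x smooth_map_on_differentiable[OF S
              smooth_map_on_bounded_bilinear[OF S bounded_bilinear_inner u u] x] unit])
    then show ?thesis
      using dir_deriv_inner[OF S u u x] by (simp add: inner_commute)
  qed
  then show "u x \<bullet> dir_deriv e u x = 0"
    using x by blast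
  have "dir_deriv e (\<lambda>y. u y \<bullet> dir_deriv e u y) x = dir_deriv e (\<lambda>y. 0) x"
    by (rule dir_deriv_cong[OF S x smooth_map_on_differentiable[OF S
            smooth_map_on_bounded_bilinear[OF S bounded_bilinear_inner u u'] x] first])
  then show "u x \<bullet> dir_deriv e (dir_deriv e u) x = - (dir_deriv e u x \<bullet> dir_deriv e u x)"
    using dir_deriv_inner[OF S u u' x] by simp
qed

lemma bounded_linear_Pair_zero: "bounded_linear (\<lambda>v. (v, 0))"
  by (intro bounded_linear_Pair bounded_linear_ident bounded_linear_zero)

lemma dir_deriv_Pair_const:
  assumes S: "open S" and u: "smooth_map_on S u" and x: "x \<in> S"
  shows "dir_deriv e (\<lambda>x. (a *\<^sub>R u x, b)) x = (a *\<^sub>R dir_deriv e u x, 0)"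
  by (rule dir_deriv_eqI)
    (intro has_derivative_Pair has_derivative_scaleR_right smooth_map_on_has_derivative[OF S u x]
      has_derivative_const)

lemma smooth_map_on_Pair_const:
  assumes S: "open S" and u: "smooth_map_on S u"
  shows "smooth_map_on S (\<lambda>x. (a *\<^sub>R u x, b))"
proof -
  have "smooth_map_on S (\<lambda>x. (a *\<^sub>R u x, 0) + (0, b))"
    by (intro smooth_map_on_add S smooth_map_on_const
        smooth_map_on_bounded_linear[OF S bounded_linear_Pair_zero]
        smooth_map_on_bounded_linear[OF S bounded_linear_scaleR_right] u)
  then show ?thesis
    by simp
qed

lemma tangent_proj_scaleR: "tangent_proj p (a *\<^sub>R v) = a *\<^sub>R tangent_proj p v"
  by (simp add: tangent_proj_def algebra_simps)

lemma tangent_proj_diff: "tangent_proj p (v - w) = tangent_proj p v - tangent_proj p w"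
  by (simp add: tangent_proj_def algebra_simps)

text \<open>The computation of tension and bitension only uses that \<open>u\<close> is an eigenmap into the unit sphere,
  constant along rays. The numbers \<open>s\<close> and \<open>c\<close> stand for the sine and cosine of the angle.\<close>

locale sphere_eigenmap =
  fixes u :: "'a::euclidean_space \<Rightarrow> 'b::euclidean_space" and \<mu> s c :: real
  assumes smooth: "smooth_map_on (UNIV - {0}) u"
    and unit: "\<And>x. x \<noteq> 0 \<Longrightarrow> u x \<bullet> u x = 1"
    and eigen: "\<And>x. x \<noteq> 0 \<Longrightarrow> laplacian u x = - (\<mu> * (1 / norm x)\<^sup>2) *\<^sub>R u x"
    and radial: "\<And>x. x \<noteq> 0 \<Longrightarrow> dir_deriv x u x = 0"
    and pythagoras: "s\<^sup>2 + c\<^sup>2 = 1"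
begin

definition lift :: "'a \<Rightarrow> 'b \<times> real" where
  "lift x = (s *\<^sub>R u x, c)"

text \<open>The unit normal, inside the sphere, of the small sphere at height \<open>c\<close>, along the image of \<open>lift\<close>.\<close>

definition conormal :: "'a \<Rightarrow> 'b \<times> real" where
  "conormal x = (- c *\<^sub>R u x, s)"

text \<open>The coefficient of the tension field with respect to \<open>conormal\<close>.\<close>

definition factor :: "'a \<Rightarrow> real" where
  "factor x = \<mu> * s * c * (1 / norm x) ^ 2"

lemma inner_lift:
  assumes "x \<noteq> 0"
  shows "lift x \<bullet> lift x = 1" "conormal x \<bullet> lift x = 0" "(v, 0) \<bullet> lift x = s * (v \<bullet> u x)"
  using unit[OF assms] pythagoras by (simp_all add: lift_def conormal_def power2_eq_square)

lemma derivative_orthogonal: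
  assumes "x \<noteq> 0"
  shows "dir_deriv e u x \<bullet> u x = 0"
    and "dir_deriv e (dir_deriv e u) x \<bullet> u x = - (dir_deriv e u x \<bullet> dir_deriv e u x)"
  using unit_map_derivatives[OF open_punctured smooth] unit assms by (simp_all add: inner_commute)

lemma energy_density:
  assumes x: "x \<noteq> 0"
  shows "(\<Sum>e\<in>Basis. dir_deriv e u x \<bullet> dir_deriv e u x) = \<mu> * (1 / norm x)\<^sup>2"
proof -
  have "(\<Sum>e\<in>Basis. dir_deriv e u x \<bullet> dir_deriv e u x) = - (laplacian u x \<bullet> u x)"
    using derivative_orthogonal(2)[OF x] by (simp add: laplacian_def inner_sum_left sum_negf)
  then show ?thesis
    using eigen[OF x] unit[OF x] by simp
qed

lemma dir_deriv_lift: "x \<noteq> 0 \<Longrightarrow> dir_deriv e lift x = (s *\<^sub>R dir_deriv e u x, 0)"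
  unfolding lift_def[abs_def] by (intro dir_deriv_Pair_const[OF open_punctured smooth]) simp

lemma dir_deriv_conormal: "x \<noteq> 0 \<Longrightarrow> dir_deriv e conormal x = (- c *\<^sub>R dir_deriv e u x, 0)"
  unfolding conormal_def[abs_def] by (intro dir_deriv_Pair_const[OF open_punctured smooth]) simp

lemma smooth_lift: "smooth_map_on (UNIV - {0}) lift"
  unfolding lift_def[abs_def] by (rule smooth_map_on_Pair_const[OF open_punctured smooth])

lemma smooth_conormal: "smooth_map_on (UNIV - {0}) conormal"
  unfolding conormal_def[abs_def] by (rule smooth_map_on_Pair_const[OF open_punctured smooth])

lemma smooth_factor: "smooth_map_on (UNIV - {0}) factor"
  unfolding factor_def[abs_def]
  by (rule smooth_map_on_bounded_linear[OF open_punctured bounded_linear_mult_right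
        smooth_map_on_inverse_norm_power])

text \<open>The Laplacian of \<open>u\<close> is a multiple of \<open>u\<close>, so its tangential part is the tangential part of
  \<open>(u, 0)\<close>, which is \<open>- c\<close> times the conormal. Both the tension and the rough Laplacian of the tension
  reduce to this sum.\<close>

lemma tangential_laplacian:
  assumes x: "x \<noteq> 0"
  shows "(\<Sum>e\<in>Basis. tangent_proj (lift x) (dir_deriv e (dir_deriv e u) x, 0))
    = (\<mu> * c * (1 / norm x)\<^sup>2) *\<^sub>R conormal x"
proof -
  \<comment> \<open>Folding the eigenvalue into one symbol keeps the arithmetic free of divisions.\<close>
  define L where "L = \<mu> * (1 / norm x)\<^sup>2"
  have eigen: "laplacian u x = - L *\<^sub>R u x"
    unfolding L_def by (rule eigen[OF x])
  have "(\<Sum>e\<in>Basis. tangent_proj (lift x) (dir_deriv e (dir_deriv e u) x, 0))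
      = (\<Sum>e\<in>Basis. (dir_deriv e (dir_deriv e u) x, 0))
        - (\<Sum>e\<in>Basis. (dir_deriv e (dir_deriv e u) x, 0::real) \<bullet> lift x) *\<^sub>R lift x"
    unfolding tangent_proj_def by (simp add: sum_subtractf scaleR_sum_left)
  also have "(\<Sum>e\<in>Basis. (dir_deriv e (dir_deriv e u) x, 0::real)) = (laplacian u x, 0)"
    by (simp add: laplacian_def prod_eq_iff fst_sum snd_sum)
  also have "(\<Sum>e\<in>Basis. (dir_deriv e (dir_deriv e u) x, 0::real) \<bullet> lift x) = s * (laplacian u x \<bullet> u x)"
    by (simp add: laplacian_def inner_lift(3)[OF x] inner_sum_left sum_distrib_left)
  also have "(laplacian u x, 0) - (s * (laplacian u x \<bullet> u x)) *\<^sub>R lift x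
      = (- (L * (1 - s\<^sup>2)) *\<^sub>R u x, L * c * s)"
    by (simp only: eigen inner_scaleR_left unit[OF x])
      (simp add: lift_def power2_eq_square algebra_simps)
  also have "\<dots> = (\<mu> * c * (1 / norm x)\<^sup>2) *\<^sub>R conormal x"
  proof -
    have "1 - s\<^sup>2 = c * c"
      using pythagoras by (simp add: power2_eq_square)
    then show ?thesis
      by (simp only: conormal_def) (simp add: L_def mult_ac)
  qed
  finally show ?thesis .
qed

lemma tension_lift:
  assumes x: "x \<noteq> 0"
  shows "tension lift x = factor x *\<^sub>R conormal x"
proof -
  have S: "x \<in> UNIV - {0}"
    using x by simp
  have "dir_deriv e (dir_deriv e lift) x = s *\<^sub>R (dir_deriv e (dir_deriv e u) x, 0)" for e
  proof -
    have "dir_deriv e (dir_deriv e lift) x = dir_deriv e (\<lambda>y. (s *\<^sub>R dir_deriv e u y, 0)) x"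
      by (rule dir_deriv_cong[OF open_punctured S smooth_map_on_differentiable[OF open_punctured
              smooth_map_on_dir_deriv[OF smooth_lift] S]]) (rule dir_deriv_lift, simp)
    also have "\<dots> = (s *\<^sub>R dir_deriv e (dir_deriv e u) x, 0)"
      by (rule dir_deriv_Pair_const[OF open_punctured smooth_map_on_dir_deriv[OF smooth] S])
    finally show ?thesis by simp
  qed
  then have "tension lift x
      = s *\<^sub>R (\<Sum>e\<in>Basis. tangent_proj (lift x) (dir_deriv e (dir_deriv e u) x, 0))"
    by (simp only: tension_def pullback_conn_def tangent_proj_scaleR scaleR_sum_right)
  then show ?thesis
    by (simp add: tangential_laplacian[OF x] factor_def mult_ac)
qed

text \<open>The derivatives of the conormal and of \<open>lift\<close> are both multiples of \<open>(\<partial>\<^sub>e u, 0)\<close>, which is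
  already tangent to the sphere, so the projection changes nothing.\<close>

lemma pullback_conn_tension:
  assumes x: "x \<noteq> 0"
  shows "pullback_conn lift e (tension lift) x
    = dir_deriv e factor x *\<^sub>R conormal x - (c * factor x) *\<^sub>R (dir_deriv e u x, 0)"
proof -
  have S: "x \<in> UNIV - {0}"
    using x by simp
  have "dir_deriv e (\<lambda>y. factor y *\<^sub>R conormal y) x = dir_deriv e (tension lift) x"
    by (rule dir_deriv_cong[OF open_punctured S smooth_map_on_differentiable[OF open_punctured
            smooth_map_on_scaleR[OF open_punctured smooth_factor smooth_conormal] S]])
      (rule tension_lift[symmetric], simp)
  then have "dir_deriv e (tension lift) x
      = factor x *\<^sub>R dir_deriv e conormal x + dir_deriv e factor x *\<^sub>R conormal x"
    using dir_deriv_scaleR[OF open_punctured smooth_factor smooth_conormal S, of e] by (simp only:)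
  also have "\<dots> = dir_deriv e factor x *\<^sub>R conormal x - (c * factor x) *\<^sub>R (dir_deriv e u x, 0)"
    by (simp add: dir_deriv_conormal[OF x] algebra_simps zero_prod_def)
  finally have *: "dir_deriv e (tension lift) x
      = dir_deriv e factor x *\<^sub>R conormal x - (c * factor x) *\<^sub>R (dir_deriv e u x, 0)" .
  show ?thesis
    unfolding pullback_conn_def * tangent_proj_def inner_diff_left inner_scaleR_left
    by (simp only: inner_lift[OF x] derivative_orthogonal(1)[OF x]) (simp add: zero_prod_def)
qed

lemma second_pullback_conn_tension:
  assumes x: "x \<noteq> 0"
  shows "pullback_conn lift e (pullback_conn lift e (tension lift)) x
    = dir_deriv e (dir_deriv e factor) x *\<^sub>R conormal x
      - (2 * c * dir_deriv e factor x) *\<^sub>R (dir_deriv e u x, 0)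
      - (c * factor x) *\<^sub>R tangent_proj (lift x) (dir_deriv e (dir_deriv e u) x, 0)"
proof -
  have S: "x \<in> UNIV - {0}"
    using x by simp
  \<comment> \<open>The two summands of \<open>pullback_conn_tension\<close>; the sign of the second one is put inside the pair.\<close>
  define F where "F y = dir_deriv e factor y *\<^sub>R conormal y" for y
  define G where "G y = factor y *\<^sub>R (- c *\<^sub>R dir_deriv e u y, 0::real)" for y
  have sm: "smooth_map_on (UNIV - {0}) (dir_deriv e factor)"
      "smooth_map_on (UNIV - {0}) (\<lambda>y. (- c *\<^sub>R dir_deriv e u y, 0::real))"
    by (rule smooth_map_on_dir_deriv smooth_factor smooth_map_on_Pair_const smooth open_punctured)+
  have FG: "smooth_map_on (UNIV - {0}) F" "smooth_map_on (UNIV - {0}) G"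
    unfolding F_def[abs_def] G_def[abs_def]
    by (rule smooth_map_on_scaleR[OF open_punctured] sm smooth_factor smooth_conormal)+
  have 1: "dir_deriv e (\<lambda>y. F y + G y) x = dir_deriv e (pullback_conn lift e (tension lift)) x"
    by (rule dir_deriv_cong[OF open_punctured S smooth_map_on_differentiable[OF open_punctured
            smooth_map_on_add[OF open_punctured FG] S]])
      (simp add: F_def G_def pullback_conn_tension)
  have 2: "dir_deriv e (\<lambda>y. F y + G y) x = dir_deriv e F x + dir_deriv e G x"
    by (rule dir_deriv_add[OF open_punctured FG S])
  have 3: "dir_deriv e F x = dir_deriv e factor x *\<^sub>R dir_deriv e conormal x
      + dir_deriv e (dir_deriv e factor) x *\<^sub>R conormal x"
    unfolding F_def[abs_def] by (rule dir_deriv_scaleR[OF open_punctured sm(1) smooth_conormal S])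
  have 4: "dir_deriv e G x = factor x *\<^sub>R dir_deriv e (\<lambda>y. (- c *\<^sub>R dir_deriv e u y, 0::real)) x
      + dir_deriv e factor x *\<^sub>R (- c *\<^sub>R dir_deriv e u x, 0)"
    unfolding G_def[abs_def] by (rule dir_deriv_scaleR[OF open_punctured smooth_factor sm(2) S])
  have 5: "dir_deriv e (\<lambda>y. (- c *\<^sub>R dir_deriv e u y, 0::real)) x
      = (- c *\<^sub>R dir_deriv e (dir_deriv e u) x, 0)"
    by (rule dir_deriv_Pair_const[OF open_punctured smooth_map_on_dir_deriv[OF smooth] S])
  have *: "dir_deriv e (pullback_conn lift e (tension lift)) x
      = dir_deriv e (dir_deriv e factor) x *\<^sub>R conormal x
        - (2 * c * dir_deriv e factor x) *\<^sub>R (dir_deriv e u x, 0)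
        - (c * factor x) *\<^sub>R (dir_deriv e (dir_deriv e u) x, 0)"
  proof -
    have double: "(c * (2 * d)) *\<^sub>R v = (c * d) *\<^sub>R v + (c * d) *\<^sub>R v" for d and v :: 'b
      by (simp add: scaleR_add_left[symmetric])
    show ?thesis
      unfolding 1[symmetric] 2 3 4 5
      by (simp add: dir_deriv_conormal[OF x] algebra_simps prod_eq_iff double)
  qed
  have "pullback_conn lift e (pullback_conn lift e (tension lift)) x
      = tangent_proj (lift x) (dir_deriv e (dir_deriv e factor) x *\<^sub>R conormal x
        - (2 * c * dir_deriv e factor x) *\<^sub>R (dir_deriv e u x, 0)
        - (c * factor x) *\<^sub>R (dir_deriv e (dir_deriv e u) x, 0))"
    unfolding pullback_conn_def[of _ _ "pullback_conn lift e (tension lift)"] * ..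
  also have "\<dots> = dir_deriv e (dir_deriv e factor) x *\<^sub>R tangent_proj (lift x) (conormal x)
        - (2 * c * dir_deriv e factor x) *\<^sub>R tangent_proj (lift x) (dir_deriv e u x, 0)
        - (c * factor x) *\<^sub>R tangent_proj (lift x) (dir_deriv e (dir_deriv e u) x, 0)"
    by (simp only: tangent_proj_diff tangent_proj_scaleR)
  also have "tangent_proj (lift x) (conormal x) = conormal x"
    by (simp add: tangent_proj_def inner_lift[OF x])
  also have "tangent_proj (lift x) (dir_deriv e u x, 0) = (dir_deriv e u x, 0)"
    by (simp only: tangent_proj_def inner_lift[OF x] derivative_orthogonal(1)[OF x]) (simp add: zero_prod_def)
  finally show ?thesis .
qed

lemma laplacian_factor:
  assumes x: "x \<noteq> 0"
  shows "laplacian factor x = \<mu> * s * c * (2 * (4 - real DIM('a)) * (1 / norm x) ^ 4)"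
proof -
  have "laplacian factor x = \<mu> * s * c * laplacian (\<lambda>x. (1 / norm x) ^ 2) x"
    unfolding factor_def[abs_def] using x
    by (intro laplacian_bounded_linear[OF open_punctured bounded_linear_mult_right
          smooth_map_on_inverse_norm_power]) simp
  then show ?thesis
    using laplacian_inverse_norm_power[OF x, of 2] by simp
qed

text \<open>The gradient of the radial function \<open>factor\<close> points along the ray, on which \<open>u\<close> is constant.\<close>

lemma sum_dir_deriv_factor:
  assumes x: "x \<noteq> 0"
  shows "(\<Sum>e\<in>Basis. dir_deriv e factor x *\<^sub>R dir_deriv e u x) = 0"
proof -
  have S: "x \<in> UNIV - {0}"
    using x by simp
  have "dir_deriv e factor x = \<mu> * s * c * (- real 2 * (1 / norm x) ^ (2 + 2) * (x \<bullet> e))" for e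
    unfolding factor_def[abs_def] dir_deriv_inverse_norm_power[OF x, symmetric]
    by (rule dir_deriv_bounded_linear[OF open_punctured bounded_linear_mult_right
          smooth_map_on_inverse_norm_power S])
  then have "(\<Sum>e\<in>Basis. dir_deriv e factor x *\<^sub>R dir_deriv e u x)
      = (\<mu> * s * c * (- real 2 * (1 / norm x) ^ (2 + 2))) *\<^sub>R (\<Sum>e\<in>Basis. (x \<bullet> e) *\<^sub>R dir_deriv e u x)"
    by (simp only: scaleR_sum_right scaleR_scaleR mult.assoc)
  then show ?thesis
    using dir_deriv_eq_sum_Basis[OF open_punctured smooth S, of x] radial[OF x] by simp
qed

lemma rough_laplacian_tension:
  assumes x: "x \<noteq> 0"
  shows "rough_laplacian lift (tension lift) x
    = (\<mu> * s * c * (1 / norm x) ^ 4 * (2 * (4 - real DIM('a)) - \<mu> * c\<^sup>2)) *\<^sub>R conormal x"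
proof -
  have "rough_laplacian lift (tension lift) x = laplacian factor x *\<^sub>R conormal x
      - (2 * c) *\<^sub>R (\<Sum>e\<in>Basis. dir_deriv e factor x *\<^sub>R dir_deriv e u x, 0)
      - (c * factor x) *\<^sub>R (\<Sum>e\<in>Basis. tangent_proj (lift x) (dir_deriv e (dir_deriv e u) x, 0))"
  proof -
    have "(\<Sum>e\<in>Basis. dir_deriv e factor x *\<^sub>R dir_deriv e u x, 0)
        = (\<Sum>e\<in>Basis. dir_deriv e factor x *\<^sub>R (dir_deriv e u x, 0::real))"
      by (simp add: prod_eq_iff fst_sum snd_sum)
    then show ?thesis
      unfolding rough_laplacian_def second_pullback_conn_tension[OF x] laplacian_def
      by (simp only: sum_subtractf scaleR_sum_left scaleR_sum_right scaleR_scaleR mult.assoc)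
  qed
  also have "\<dots> = (laplacian factor x - c * factor x * (\<mu> * c * (1 / norm x)\<^sup>2)) *\<^sub>R conormal x"
    unfolding sum_dir_deriv_factor[OF x] tangential_laplacian[OF x]
    by (simp add: zero_prod_def[symmetric] scaleR_diff_left)
  also have "laplacian factor x - c * factor x * (\<mu> * c * (1 / norm x)\<^sup>2)
      = \<mu> * s * c * (1 / norm x) ^ 4 * (2 * (4 - real DIM('a)) - \<mu> * c\<^sup>2)"
  proof -
    \<comment> \<open>The claim is a polynomial identity in \<open>R\<close>.\<close>
    define R where "R = (1 / norm x)\<^sup>2"
    have "(1 / norm x) ^ 4 = R * R"
      by (simp add: R_def power2_eq_square power4_eq_xxxx)
    then show ?thesis
      unfolding laplacian_factor[OF x] factor_def R_def[symmetric]
      by (simp only:) (simp add: power2_eq_square algebra_simps)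
  qed
  finally show ?thesis .
qed

text \<open>The tension field is orthogonal to the image of the differential, so of the two terms of the
  curvature tensor only the one with the energy density remains.\<close>

lemma curvature_lift:
  assumes x: "x \<noteq> 0"
  shows "(\<Sum>e\<in>Basis. sphere_curvature (lift x) (tension lift x) (dir_deriv e lift x) (dir_deriv e lift x))
    = (s\<^sup>2 * \<mu> * (1 / norm x)\<^sup>2 * factor x) *\<^sub>R conormal x"
proof -
  have perp: "conormal x \<bullet> (dir_deriv e u x, 0) = 0" for e
    using derivative_orthogonal(1)[OF x] by (simp add: conormal_def inner_commute)
  have *: "sphere_curvature (lift x) (tension lift x) (dir_deriv e lift x) (dir_deriv e lift x)
      = (dir_deriv e u x \<bullet> dir_deriv e u x) *\<^sub>R (s\<^sup>2 * factor x) *\<^sub>R conormal x" for e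
  proof -
    have q: "dir_deriv e lift x = s *\<^sub>R (dir_deriv e u x, 0)"
      using dir_deriv_lift[OF x] by simp
    have "dir_deriv e lift x \<bullet> lift x = 0" "tension lift x \<bullet> lift x = 0"
      "tension lift x \<bullet> dir_deriv e lift x = 0"
      by (simp_all only: q tension_lift[OF x] inner_scaleR_left inner_scaleR_right inner_lift[OF x]
          derivative_orthogonal(1)[OF x] perp mult_zero_right)
    moreover have "norm (lift x) = 1"
      using inner_lift(1)[OF x] by (simp add: norm_eq_1)
    ultimately have "sphere_curvature (lift x) (tension lift x) (dir_deriv e lift x) (dir_deriv e lift x)
        = (dir_deriv e lift x \<bullet> dir_deriv e lift x) *\<^sub>R tension lift x"
      by (simp add: sphere_curvature_eq)
    then show ?thesis
      unfolding q tension_lift[OF x] by (simp add: power2_eq_square mult_ac)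
  qed
  show ?thesis
    unfolding * scaleR_sum_left[symmetric] energy_density[OF x] by (simp add: mult_ac)
qed

text \<open>The terms \<open>- \<mu> c\<^sup>2\<close> from the connection and \<open>\<mu> s\<^sup>2\<close> from the curvature combine to
  \<open>\<mu> (2 s\<^sup>2 - 1)\<close>; the remaining summand comes from the Laplacian of \<open>r\<^sup>-\<^sup>2\<close>.\<close>

lemma bitension_lift:
  assumes x: "x \<noteq> 0"
  shows "bitension lift x
    = (\<mu> * s * c * (1 / norm x) ^ 4 * (2 * (4 - real DIM('a)) + \<mu> * (2 * s\<^sup>2 - 1))) *\<^sub>R conormal x"
proof -
  have "(1 / norm x) ^ 4 = (1 / norm x)\<^sup>2 * (1 / norm x)\<^sup>2"
    by (simp add: power2_eq_square power4_eq_xxxx)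
  then have "\<mu> * s * c * (1 / norm x) ^ 4 * (2 * (4 - real DIM('a)) - \<mu> * c\<^sup>2)
      + s\<^sup>2 * \<mu> * (1 / norm x)\<^sup>2 * factor x
    = \<mu> * s * c * (1 / norm x) ^ 4 * (2 * (4 - real DIM('a)) + \<mu> * (s\<^sup>2 - c\<^sup>2))"
    unfolding factor_def by (simp only:) (simp add: algebra_simps)
  moreover have "s\<^sup>2 - c\<^sup>2 = 2 * s\<^sup>2 - 1"
    using pythagoras by linarith
  ultimately show ?thesis
    unfolding bitension_def rough_laplacian_tension[OF x] curvature_lift[OF x] scaleR_add_left[symmetric]
    by simp
qed

lemma smooth_sphere_map_lift: "smooth_sphere_map_on (UNIV - {0}) lift"
proof -
  have "norm (lift x) = 1" if "x \<noteq> 0" for x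
    using inner_lift(1)[OF that] by (simp add: norm_eq_1)
  then show ?thesis
    by (simp add: smooth_sphere_map_on_def smooth_lift image_subset_iff open_punctured)
qed

lemma conormal_nonzero: "x \<noteq> 0 \<Longrightarrow> conormal x \<noteq> 0"
  using pythagoras unit[of x] by (auto simp: conormal_def zero_prod_def)

lemma proper_biharmonic_lift_iff:
  assumes "\<mu> \<noteq> 0" "s \<noteq> 0" "c \<noteq> 0"
  shows "proper_biharmonic_map_on (UNIV - {0}) lift \<longleftrightarrow>
    2 * (4 - real DIM('a)) + \<mu> * (2 * s\<^sup>2 - 1) = 0"
proof -
  \<comment> \<open>Some point of the punctured space is needed to refute harmonicity and vanishing of the bitension.\<close>
  obtain b :: 'a where b: "b \<in> Basis"
    using nonempty_Basis by blast
  then have b0: "b \<noteq> 0"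
    by auto
  have "tension lift b \<noteq> 0"
    using assms b0 conormal_nonzero[OF b0] by (simp add: tension_lift factor_def)
  then have "\<not> harmonic_map_on (UNIV - {0}) lift"
    using b0 by (auto simp: harmonic_map_on_def)
  moreover have "bitension lift x = 0 \<longleftrightarrow> 2 * (4 - real DIM('a)) + \<mu> * (2 * s\<^sup>2 - 1) = 0"
    if "x \<noteq> 0" for x
    unfolding bitension_lift[OF that] using assms that conormal_nonzero[OF that] by simp
  ultimately show ?thesis
    using b0 smooth_sphere_map_lift
    by (auto simp: proper_biharmonic_map_on_def biharmonic_map_on_def)
qed

end

lemma smooth_map_on_vec:
  fixes f :: "'k::finite \<Rightarrow> 'a::euclidean_space \<Rightarrow> real"
  assumes S: "open S" and f: "\<And>k. smooth_map_on S (f k)"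
  shows "smooth_map_on S (\<lambda>x. \<chi> k. f k x)"
proof -
  have "(\<lambda>x. \<chi> k. f k x) = (\<lambda>x. \<Sum>k\<in>UNIV. f k x *\<^sub>R axis k 1)"
    by (simp add: fun_eq_iff vec_eq_iff axis_def if_distrib cong: if_cong)
  then show ?thesis
    by (simp only:) (intro smooth_map_on_sum smooth_map_on_scaleR smooth_map_on_const S f)
qed

lemma nakauchi_map_sphere_eigenmap:
  fixes idx :: "'k::finite \<Rightarrow> nat \<Rightarrow> 'm::finite"
  assumes idx: "bij_betw idx UNIV ({1..l} \<rightarrow>\<^sub>E UNIV)" and l: "1 \<le> l" and m: "2 \<le> CARD('m)"
    and pyth: "s\<^sup>2 + c\<^sup>2 = 1"
  shows "sphere_eigenmap (nakauchi_map idx l) (real l * (real l + real CARD('m) - 2)) s c"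
proof -
  obtain n where n: "l = Suc n"
    using l by (cases l) auto
  note comp = nakauchi_comp_eigenfunction[OF m, of n]
  have smooth: "smooth_map_on (UNIV - {0}) (nakauchi_map idx l)"
    unfolding nakauchi_map_def[abs_def] n using comp by (intro smooth_map_on_vec open_punctured) blast
  have hom: "nakauchi_map idx l (t *\<^sub>R x) = nakauchi_map idx l x" if "0 < t" for t x
    unfolding nakauchi_map_def n using comp that by (simp only: simp_thms)
  have L: "real (Suc n) * real (n + CARD('m) - 1) = real l * (real l + real CARD('m) - 2)"
    using m by (simp add: n of_nat_diff)
  show ?thesis
  proof
    show "nakauchi_map idx l x \<bullet> nakauchi_map idx l x = 1" if x: "x \<noteq> 0" for x
    proof -
      have "nakauchi_map idx l x \<bullet> nakauchi_map idx l x = (\<Sum>k\<in>UNIV. (nakauchi_comp (Suc n) (idx k) x)\<^sup>2)"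
        by (simp add: inner_vec_def nakauchi_map_def n power2_eq_square)
      also have "\<dots> = (\<Sum>i\<in>{1..Suc n} \<rightarrow>\<^sub>E UNIV. (nakauchi_comp (Suc n) i x)\<^sup>2)"
        by (rule sum.reindex_bij_betw[OF idx[unfolded n]])
      also have "\<dots> = 1"
        by (rule sum_nakauchi_comp_squares[OF m x])
      finally show ?thesis .
    qed
    show "laplacian (nakauchi_map idx l) x
        = - (real l * (real l + real CARD('m) - 2) * (1 / norm x)\<^sup>2) *\<^sub>R nakauchi_map idx l x"
      if x: "x \<noteq> 0" for x
    proof (rule vec_eq_iff[THEN iffD2], rule allI)
      fix k
      have "laplacian (nakauchi_map idx l) x $ k = laplacian (\<lambda>x. nakauchi_map idx l x $ k) x"
        using x by (intro laplacian_bounded_linear[OF open_punctured bounded_linear_vec_nth smooth, symmetric]) simp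
      also have "(\<lambda>x. nakauchi_map idx l x $ k) = nakauchi_comp (Suc n) (idx k)"
        by (simp add: nakauchi_map_def n)
      also have "laplacian (nakauchi_comp (Suc n) (idx k)) x
          = - (real (Suc n) * real (n + CARD('m) - 1)) * (1 / norm x)\<^sup>2 * nakauchi_comp (Suc n) (idx k) x"
        using comp x by blast
      also have "\<dots> = (- (real l * (real l + real CARD('m) - 2) * (1 / norm x)\<^sup>2) *\<^sub>R nakauchi_map idx l x) $ k"
        unfolding L by (simp add: nakauchi_map_def n)
      finally show "laplacian (nakauchi_map idx l) x $ k
          = (- (real l * (real l + real CARD('m) - 2) * (1 / norm x)\<^sup>2) *\<^sub>R nakauchi_map idx l x) $ k" .
    qed
    show "dir_deriv x (nakauchi_map idx l) x = 0" if "x \<noteq> 0" for x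
      using that by (intro homogeneous_dir_deriv_radial[OF open_punctured smooth _ hom]) simp_all
  qed (rule smooth pyth)+
qed

theorem theorem3p2:
  fixes m l :: nat and \<alpha> :: real
    and idx :: "'k::finite \<Rightarrow> nat \<Rightarrow> 'm::finite"
    and q :: "real ^ 'm \<Rightarrow> (real ^ 'k) \<times> real"
  assumes "CARD('m) = m"
    and "bij_betw idx UNIV ({1..l} \<rightarrow>\<^sub>E UNIV)"
    and "1 \<le> l" and "l \<le> m" and "(m, l) \<noteq> (1, 1)"
    and "0 < \<alpha>" and "\<alpha> < pi / 2"
    and "q = (\<lambda>x. (sin \<alpha> *\<^sub>R nakauchi_map idx l x, cos \<alpha>))"
  shows "proper_biharmonic_map_on (UNIV - {0}) q \<longleftrightarrow>
    (sin \<alpha>)\<^sup>2 = (real l * (real l + real m - 2) + 2 * real m - 8)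
                   / (2 * real l * (real l + real m - 2))"
proof -
  define \<mu> where "\<mu> = real l * (real l + real m - 2)"
  \<comment> \<open>In dimension 1 the bound \<open>l \<le> m\<close> leaves only the excluded pair.\<close>
  have m: "2 \<le> m"
    using assms(3-5) by (cases "m = 1") auto
  then have \<mu>: "0 < \<mu>"
    using assms(3) by (simp add: \<mu>_def)
  have trig: "0 < sin \<alpha>" "0 < cos \<alpha>"
    using assms(6,7) by (auto intro: sin_gt_zero cos_gt_zero)
  interpret sphere_eigenmap "nakauchi_map idx l" \<mu> "sin \<alpha>" "cos \<alpha>"
    using nakauchi_map_sphere_eigenmap[OF assms(2,3), of "sin \<alpha>" "cos \<alpha>"] m assms(1)
    by (simp add: \<mu>_def)
  have "q = lift"
    by (simp add: assms(8) lift_def fun_eq_iff)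
  then have "proper_biharmonic_map_on (UNIV - {0}) q \<longleftrightarrow>
      2 * (4 - real m) + \<mu> * (2 * (sin \<alpha>)\<^sup>2 - 1) = 0"
    using proper_biharmonic_lift_iff \<mu> trig assms(1) by simp
  also have "\<dots> \<longleftrightarrow> (sin \<alpha>)\<^sup>2 = (\<mu> + 2 * real m - 8) / (2 * \<mu>)"
    using \<mu> by (auto simp: field_simps)
  finally show ?thesis
    by (simp add: \<mu>_def mult.assoc)
qed

end
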